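(* Let $\lambda\in\mathbb R$, $\lambda\notin\mathrm{Sp}(\mathrm{rot})$, let $m>0$ be an integer and let $k$ be an integer. Then the operator $\mathrm{rot}+\lambda I$ maps the class $\mathbf C(2k,m+1)$ onto $\mathbf C(2k,m)$ bijectively and continuously, and its inverse maps $\mathbf C(2k,m)$ onto $\mathbf C(2k,m+1)$ bijectively and continuously.
   Context: $\Omega\subset\mathbb R^3$ is a bounded domain with smooth boundary, homeomorphic to a ball; $\mathbf n$ is the unit normal, $\gamma$ the boundary trace; $\mathbf L_2(\Omega)$ is the real Hilbert space of square integrable vector fields with inner product $(\cdot,\cdot)$. $\mathcal A=\{\nabla h:h\in H^1(\Omega)\}$, and $\mathcal B=\mathbf V^0$ is its orthogonal complement in $\mathbf L_2(\Omega)$. $\{\mathbf q_j\}$ is an orthonormal basis of $\mathcal A$ with $\mathbf q_j\in\mathbf C^\infty(\overline\Omega)$, $-\nabla\mathrm{div}\,\mathbf q_j=\nu_j^2\mathbf q_j$, $\gamma(\mathbf n\cdot\mathbf q_j)=0$, $0<\nu_1^2\le\nu_2^2\le\dots$. $S$ is the self-adjoint operator in $\mathbf V^0$ with domain $\{\mathbf f\in\mathbf V^0:\mathrm{rot}\,\mathbf f\in\mathbf V^0\}$ and $S\mathbf f=\mathrm{rot}\,\mathbf f$. Standing convention: its eigenvalues come in pairs $\pm\lambda_j$, $0<\lambda_1\le\lambda_2\le\dots$, and $\{\mathbf q_j^+,\mathbf q_j^-\}$ is an orthonormal basis of $\mathbf V^0$ with $\mathbf q_j^\pm\in\mathbf C^\infty(\overline\Omega)$,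 $\mathrm{rot}\,\mathbf q_j^\pm=\pm\lambda_j\mathbf q_j^\pm$, $\gamma(\mathbf n\cdot\mathbf q_j^\pm)=0$. For an integer $k$, $\mathbf A^{2k}$ is the Hilbert space of coefficient sequences $f_j=(\mathbf f,\mathbf q_j)$ with norm squared $\sum_j\nu_j^{4k}f_j^2<\infty$ (for $k\ge0$, these are the fields $\mathbf f=\sum_jf_j\mathbf q_j\in\mathcal A$; for $k<0$, functionals). For an integer $m$, $\mathbf W^m$ is the Hilbert space of coefficient sequences $f_j^\pm=(\mathbf f,\mathbf q_j^\pm)$ with norm squared $\sum_j\lambda_j^{2m}[(f_j^+)^2+(f_j^-)^2]<\infty$ (for $m\ge0$ this is $\{\mathbf f\in\mathbf V^0,\dots,\mathrm{rot}^m\mathbf f\in\mathbf V^0\}$). $\mathbf C(2k,m)=\mathbf A^{2k}\oplus\mathbf W^m$. rot annihilates the $\mathbf A^{2k}$ component and acts as $S$ on the $\mathbf W^{m+1}$ component, so $(\mathrm{rot}+\lambda I)(\mathbf u_{\mathcal A}+\mathbf u_{\mathbf V})=\lambda\mathbf u_{\mathcal A}+(S+\lambda I)\mathbf u_{\mathbf V}$. $\mathrm{Sp}(\mathrm{rot})$ is the set of real $\lambda$ for which $\mathrm{rot}\,\mathbf u=\lambda\mathbf u$ in $\Omega$, $\gamma(\mathbf n\cdot\mathbf u)=0$, has a nonzero solution, i.e. $\{0\}\cup\{\pm\lambda_j\}$. *)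

theory Defs
  imports "HOL-Analysis.Analysis"
begin

section \<open>The real Hilbert space of square integrable vector fields\<close>

definition sq_integrable :: "(real^3 \<Rightarrow> real^3) \<Rightarrow> bool" where
  "sq_integrable f \<longleftrightarrow> f \<in> borel_measurable lborel \<and> integrable lborel (\<lambda>x. (norm (f x))\<^sup>2)"

lemma sq_integrable_zero: "sq_integrable (\<lambda>_. 0)"
  by (simp add: sq_integrable_def)

lemma sq_integrable_inner:
  assumes "sq_integrable f" "sq_integrable g"
  shows "integrable lborel (\<lambda>x. f x \<bullet> g x)"
proof (rule Bochner_Integration.integrable_bound)
  show "integrable lborel (\<lambda>x. (norm (f x))\<^sup>2 + (norm (g x))\<^sup>2)"
    using assms by (auto simp: sq_integrable_def)
  show "(\<lambda>x. f x \<bullet> g x) \<in> borel_measurable lborel"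
    using assms by (auto simp: sq_integrable_def)
  have "\<bar>f x \<bullet> g x\<bar> \<le> (norm (f x))\<^sup>2 + (norm (g x))\<^sup>2" for x
  proof -
    have "\<bar>f x \<bullet> g x\<bar> \<le> norm (f x) * norm (g x)"
      by (rule Cauchy_Schwarz_ineq2)
    moreover have "2 * (norm (f x) * norm (g x)) \<le> (norm (f x))\<^sup>2 + (norm (g x))\<^sup>2"
      using sum_squares_bound[of "norm (f x)" "norm (g x)"] by (simp add: mult.assoc)
    moreover have "0 \<le> norm (f x) * norm (g x)"
      by simp
    ultimately show ?thesis by linarith
  qed
  then show "AE x in lborel. norm (f x \<bullet> g x) \<le> norm ((norm (f x))\<^sup>2 + (norm (g x))\<^sup>2)"
    by simp
qed

lemma sq_integrable_add:
  assumes "sq_integrable f" "sq_integrable g"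
  shows "sq_integrable (\<lambda>x. f x + g x)"
proof -
  have "integrable lborel (\<lambda>x. (norm (f x))\<^sup>2 + 2 * (f x \<bullet> g x) + (norm (g x))\<^sup>2)"
    using assms sq_integrable_inner[OF assms] by (auto simp: sq_integrable_def)
  moreover have "(\<lambda>x. (norm (f x))\<^sup>2 + 2 * (f x \<bullet> g x) + (norm (g x))\<^sup>2)
      = (\<lambda>x. (norm (f x + g x))\<^sup>2)"
    by (auto simp: power2_norm_eq_inner inner_simps inner_commute)
  ultimately show ?thesis
    using assms by (auto simp: sq_integrable_def)
qed

lemma sq_integrable_scaleR:
  assumes "sq_integrable f" shows "sq_integrable (\<lambda>x. c *\<^sub>R f x)"
  using assms by (auto simp: sq_integrable_def power_mult_distrib)

lemma sq_integrable_minus: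
  assumes "sq_integrable f" shows "sq_integrable (\<lambda>x. - f x)"
  using sq_integrable_scaleR[OF assms, of "-1"] by simp

text \<open>Square integrable fields on the whole space, modulo equality almost everywhere. The
  space of fields over a domain is the subspace \<open>L2\<close> below of fields extended by zero.\<close>

quotient_type l2 = "real^3 \<Rightarrow> real^3" /
  partial: "\<lambda>f g. sq_integrable f \<and> sq_integrable g \<and> (AE x in lborel. f x = g x)"
proof (rule part_equivpI)
  show "\<exists>f. sq_integrable f \<and> sq_integrable f \<and> (AE x in lborel. f x = f x)"
    using sq_integrable_zero by blast
  show "symp (\<lambda>f g. sq_integrable f \<and> sq_integrable g \<and> (AE x in lborel. f x = g x))"
    by (rule sympI) (auto elim: eventually_mono)
  show "transp (\<lambda>f g. sq_integrable f \<and> sq_integrable g \<and> (AE x in lborel. f x = g x))"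
    by (rule transpI) (auto elim: eventually_elim2)
qed

instantiation l2 :: real_inner
begin

lift_definition zero_l2 :: l2 is "\<lambda>_. 0"
  by (simp add: sq_integrable_zero)

lift_definition plus_l2 :: "l2 \<Rightarrow> l2 \<Rightarrow> l2" is "\<lambda>f g x. f x + g x"
  by (auto intro: sq_integrable_add elim: eventually_elim2)

lift_definition uminus_l2 :: "l2 \<Rightarrow> l2" is "\<lambda>f x. - f x"
  by (auto intro: sq_integrable_minus elim: eventually_mono)

definition minus_l2 :: "l2 \<Rightarrow> l2 \<Rightarrow> l2" where "minus_l2 f g = f + (- g)"

lift_definition scaleR_l2 :: "real \<Rightarrow> l2 \<Rightarrow> l2" is "\<lambda>c f x. c *\<^sub>R f x"
  by (auto intro: sq_integrable_scaleR elim: eventually_mono)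

lift_definition inner_l2 :: "l2 \<Rightarrow> l2 \<Rightarrow> real" is "\<lambda>f g. LINT x|lborel. f x \<bullet> g x"
proof -
  fix f f' g g' :: "real^3 \<Rightarrow> real^3"
  assume f: "sq_integrable f \<and> sq_integrable f' \<and> (AE x in lborel. f x = f' x)"
    and g: "sq_integrable g \<and> sq_integrable g' \<and> (AE x in lborel. g x = g' x)"
  show "(LINT x|lborel. f x \<bullet> g x) = (LINT x|lborel. f' x \<bullet> g' x)"
  proof (rule integral_cong_AE)
    show "(\<lambda>x. f x \<bullet> g x) \<in> borel_measurable lborel" "(\<lambda>x. f' x \<bullet> g' x) \<in> borel_measurable lborel"
      using f g by (auto simp: sq_integrable_def)
    have "AE x in lborel. f x = f' x" "AE x in lborel. g x = g' x"
      using f g by auto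
    then show "AE x in lborel. f x \<bullet> g x = f' x \<bullet> g' x"
      by (auto elim: eventually_elim2)
  qed
qed

definition norm_l2 :: "l2 \<Rightarrow> real" where "norm_l2 f = sqrt (inner f f)"
definition sgn_l2 :: "l2 \<Rightarrow> l2" where "sgn_l2 f = inverse (norm f) *\<^sub>R f"
definition dist_l2 :: "l2 \<Rightarrow> l2 \<Rightarrow> real" where "dist_l2 f g = norm (f - g)"
definition uniformity_l2 :: "(l2 \<times> l2) filter" where
  "uniformity_l2 = (INF e\<in>{0<..}. principal {(f, g). dist f g < e})"
definition open_l2 :: "l2 set \<Rightarrow> bool" where
  "open_l2 U \<longleftrightarrow> (\<forall>f\<in>U. \<forall>\<^sub>F (f', g) in uniformity. f' = f \<longrightarrow> g \<in> U)"

instance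
proof
  fix f g h :: l2 and a b :: real
  show "f + g + h = f + (g + h)"
    by transfer (auto intro!: sq_integrable_add simp: add.assoc)
  show "f + g = g + f"
    by transfer (auto intro!: sq_integrable_add simp: add.commute)
  show "0 + f = f"
    by transfer (auto intro!: sq_integrable_add sq_integrable_zero)
  show "- f + f = 0"
    by transfer (auto intro!: sq_integrable_add sq_integrable_minus sq_integrable_zero)
  show "f - g = f + - g"
    by (rule minus_l2_def)
  show "a *\<^sub>R (f + g) = a *\<^sub>R f + a *\<^sub>R g"
    by transfer (auto intro!: sq_integrable_add sq_integrable_scaleR simp: scaleR_right_distrib)
  show "(a + b) *\<^sub>R f = a *\<^sub>R f + b *\<^sub>R f"
    by transfer (auto intro!: sq_integrable_add sq_integrable_scaleR simp: scaleR_left_distrib)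
  show "a *\<^sub>R b *\<^sub>R f = (a * b) *\<^sub>R f"
    by transfer (auto intro!: sq_integrable_scaleR)
  show "1 *\<^sub>R f = f"
    by transfer auto
  show "dist f g = norm (f - g)"
    by (rule dist_l2_def)
  show "sgn f = inverse (norm f) *\<^sub>R f"
    by (rule sgn_l2_def)
  show "uniformity = (INF e\<in>{0<..}. principal {(f :: l2, g). dist f g < e})"
    by (rule uniformity_l2_def)
  show "open U = (\<forall>f\<in>U. \<forall>\<^sub>F (f', g) in uniformity. f' = f \<longrightarrow> g \<in> U)" for U :: "l2 set"
    by (rule open_l2_def)
  show "f \<bullet> g = g \<bullet> f"
    by transfer (auto simp: inner_commute)
  show "(f + g) \<bullet> h = f \<bullet> h + g \<bullet> h"
    by transfer (auto simp: inner_add_left sq_integrable_inner)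
  show "(a *\<^sub>R f) \<bullet> g = a * (f \<bullet> g)"
    by transfer auto
  show "0 \<le> f \<bullet> f"
    by transfer auto
  show "(f \<bullet> f = 0) = (f = 0)"
  proof transfer
    fix f :: "real^3 \<Rightarrow> real^3"
    assume "sq_integrable f \<and> sq_integrable f \<and> (AE x in lborel. f x = f x)"
    then have f: "sq_integrable f" by simp
    have "((LINT x|lborel. f x \<bullet> f x) = 0) = (AE x in lborel. f x \<bullet> f x = 0)"
      by (rule integral_nonneg_eq_0_iff_AE) (auto simp: sq_integrable_inner f)
    then show "((LINT x|lborel. f x \<bullet> f x) = 0) =
        (sq_integrable f \<and> sq_integrable (\<lambda>_. 0) \<and> (AE x in lborel. f x = 0))"
      using f sq_integrable_zero by simp
  qed
  show "norm f = sqrt (f \<bullet> f)"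
    by (rule norm_l2_def)
qed

end

text \<open>The class of the restriction of \<open>f\<close> to \<open>\<Omega>\<close>, extended by zero; the junk value \<open>0\<close> is used
  when \<open>f\<close> is not square integrable over \<open>\<Omega>\<close>.\<close>

lift_definition l2class :: "(real^3) set \<Rightarrow> (real^3 \<Rightarrow> real^3) \<Rightarrow> l2" is
  "\<lambda>\<Omega> f. if sq_integrable (\<lambda>x. indicator \<Omega> x *\<^sub>R f x) then (\<lambda>x. indicator \<Omega> x *\<^sub>R f x) else (\<lambda>_. 0)"
  by (auto simp: sq_integrable_zero)

definition L2 :: "(real^3) set \<Rightarrow> l2 set" where
  "L2 \<Omega> = range (l2class \<Omega>)"


section \<open>Smooth functions and differential operators\<close>

text \<open>\<open>Ck n S f\<close>: \<open>f\<close> is \<open>n\<close> times continuously differentiable on the open set \<open>S\<close>.\<close>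

primrec Ck :: "nat \<Rightarrow> 'a::euclidean_space set \<Rightarrow> ('a \<Rightarrow> 'b::real_normed_vector) \<Rightarrow> bool" where
  "Ck 0 S f = continuous_on S f"
| "Ck (Suc n) S f = ((\<forall>x\<in>S. f differentiable (at x)) \<and>
     (\<forall>b\<in>Basis. Ck n S (\<lambda>x. frechet_derivative f (at x) b)))"

definition smooth_on :: "'a::euclidean_space set \<Rightarrow> ('a \<Rightarrow> 'b::real_normed_vector) \<Rightarrow> bool" where
  "smooth_on S f \<longleftrightarrow> (\<forall>n. Ck n S f)"

definition smooth_upto_boundary ::
    "'a::euclidean_space set \<Rightarrow> ('a \<Rightarrow> 'b::real_normed_vector) \<Rightarrow> bool" where
  "smooth_upto_boundary \<Omega> f \<longleftrightarrow> (\<exists>g. smooth_on UNIV g \<and> (\<forall>x\<in>closure \<Omega>. f x = g x))"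

definition partial_deriv :: "3 \<Rightarrow> (real^3 \<Rightarrow> 'b::real_normed_vector) \<Rightarrow> real^3 \<Rightarrow> 'b" where
  "partial_deriv i f x = frechet_derivative f (at x) (axis i 1)"

definition grad :: "(real^3 \<Rightarrow> real) \<Rightarrow> real^3 \<Rightarrow> real^3" where
  "grad h x = (\<chi> i. partial_deriv i h x)"

definition divergence :: "(real^3 \<Rightarrow> real^3) \<Rightarrow> real^3 \<Rightarrow> real" where
  "divergence f x = (\<Sum>i\<in>UNIV. partial_deriv i f x $ i)"

definition rot :: "(real^3 \<Rightarrow> real^3) \<Rightarrow> real^3 \<Rightarrow> real^3" where
  "rot f x = vector
     [partial_deriv 2 f x $ 3 - partial_deriv 3 f x $ 2,
      partial_deriv 3 f x $ 1 - partial_deriv 1 f x $ 3,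
      partial_deriv 1 f x $ 2 - partial_deriv 2 f x $ 1]"

definition test_fields :: "(real^3) set \<Rightarrow> (real^3 \<Rightarrow> real^3) set" where
  "test_fields \<Omega> = {\<phi>. smooth_on UNIV \<phi> \<and>
     compact (closure {x. \<phi> x \<noteq> 0}) \<and> closure {x. \<phi> x \<noteq> 0} \<subseteq> \<Omega>}"


section \<open>The domain, its normal and the normal trace\<close>

definition local_defining_function ::
    "(real^3) set \<Rightarrow> (real^3) set \<Rightarrow> (real^3 \<Rightarrow> real) \<Rightarrow> bool" where
  "local_defining_function \<Omega> U \<rho> \<longleftrightarrow> open U \<and> smooth_on U \<rho> \<and> (\<forall>y\<in>U. grad \<rho> y \<noteq> 0) \<and>
     \<Omega> \<inter> U = {y\<in>U. \<rho> y < 0} \<and> frontier \<Omega> \<inter> U = {y\<in>U. \<rho> y = 0}"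

definition smooth_boundary :: "(real^3) set \<Rightarrow> bool" where
  "smooth_boundary \<Omega> \<longleftrightarrow> (\<forall>x\<in>frontier \<Omega>. \<exists>U \<rho>. x \<in> U \<and> local_defining_function \<Omega> U \<rho>)"

definition unit_normal :: "(real^3) set \<Rightarrow> real^3 \<Rightarrow> real^3" where
  "unit_normal \<Omega> x = (THE n. \<exists>U \<rho>. x \<in> U \<and> local_defining_function \<Omega> U \<rho> \<and>
     n = grad \<rho> x /\<^sub>R norm (grad \<rho> x))"

definition normal_trace_zero :: "(real^3) set \<Rightarrow> (real^3 \<Rightarrow> real^3) \<Rightarrow> bool" where
  "normal_trace_zero \<Omega> u \<longleftrightarrow> (\<forall>x\<in>frontier \<Omega>. unit_normal \<Omega> x \<bullet> u x = 0)"


section \<open>Gradient fields, their complement, and the operator S\<close>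

definition weak_gradient :: "(real^3) set \<Rightarrow> (real^3 \<Rightarrow> real) \<Rightarrow> l2 \<Rightarrow> bool" where
  "weak_gradient \<Omega> h F \<longleftrightarrow>
     (\<forall>\<phi>\<in>test_fields \<Omega>. (LINT x:\<Omega>|lborel. h x * divergence \<phi> x) = - (F \<bullet> l2class \<Omega> \<phi>))"

definition H1 :: "(real^3) set \<Rightarrow> (real^3 \<Rightarrow> real) set" where
  "H1 \<Omega> = {h. set_borel_measurable lborel \<Omega> h \<and> set_integrable lborel \<Omega> (\<lambda>x. (h x)\<^sup>2) \<and>
     (\<exists>F\<in>L2 \<Omega>. weak_gradient \<Omega> h F)}"

definition gradient_fields :: "(real^3) set \<Rightarrow> l2 set" where
  "gradient_fields \<Omega> = {F \<in> L2 \<Omega>. \<exists>h\<in>H1 \<Omega>. weak_gradient \<Omega> h F}"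

definition V0 :: "(real^3) set \<Rightarrow> l2 set" where
  "V0 \<Omega> = L2 \<Omega> \<inter> (gradient_fields \<Omega>)\<^sup>\<bottom>"

definition weak_rot :: "(real^3) set \<Rightarrow> l2 \<Rightarrow> l2 \<Rightarrow> bool" where
  "weak_rot \<Omega> F G \<longleftrightarrow> (\<forall>\<phi>\<in>test_fields \<Omega>. F \<bullet> l2class \<Omega> (rot \<phi>) = G \<bullet> l2class \<Omega> \<phi>)"

definition S_graph :: "(real^3) set \<Rightarrow> (l2 \<times> l2) set" where
  "S_graph \<Omega> = {(F, G). F \<in> V0 \<Omega> \<and> G \<in> V0 \<Omega> \<and> weak_rot \<Omega> F G}"

definition S_op :: "(real^3) set \<Rightarrow> l2 \<Rightarrow> l2" where
  "S_op \<Omega> F = (THE G. (F, G) \<in> S_graph \<Omega>)"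

text \<open>Self-adjointness, in the Hilbert space \<open>H\<close>, of the operator with graph \<open>T\<close>: it is densely
  defined and coincides with its adjoint.\<close>

definition self_adjoint_in :: "'a::real_inner set \<Rightarrow> ('a \<times> 'a) set \<Rightarrow> bool" where
  "self_adjoint_in H T \<longleftrightarrow> T \<subseteq> H \<times> H \<and> H \<subseteq> closure (Domain T) \<and>
     T = {(u, v). u \<in> H \<and> v \<in> H \<and> (\<forall>(f, g)\<in>T. g \<bullet> u = f \<bullet> v)}"

definition orthonormal_basis_of :: "('i \<Rightarrow> 'a::real_inner) \<Rightarrow> 'a set \<Rightarrow> bool" where
  "orthonormal_basis_of e H \<longleftrightarrow>
     (\<forall>i j. e i \<bullet> e j = (if i = j then 1 else 0)) \<and> closure (span (range e)) = H"

text \<open>Solutions of the boundary value problem are classical: continuously differentiable inside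
  and continuous up to the boundary, so that the normal trace is a pointwise condition.\<close>

definition Sp_rot :: "(real^3) set \<Rightarrow> real set" where
  "Sp_rot \<Omega> = {\<mu>. \<exists>u. Ck 1 \<Omega> u \<and> continuous_on (closure \<Omega>) u \<and> (\<exists>x\<in>\<Omega>. u x \<noteq> 0) \<and>
     (\<forall>x\<in>\<Omega>. rot u x = \<mu> *\<^sub>R u x) \<and> normal_trace_zero \<Omega> u}"


section \<open>The spaces and the operator\<close>

text \<open>In the following, \<open>\<nu>\<close> lists the numbers \<open>\<nu>\<^sub>j\<close>, \<open>\<mu>\<close> lists the positive eigenvalues of \<open>S_op \<Omega>\<close>,
  and \<open>qp\<close>, \<open>qm\<close> list the eigenfields for \<open>\<mu> j\<close> and \<open>- \<mu> j\<close>. Elements of the gradient component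
  are functionals for negative \<open>k\<close> and are represented by their coefficient sequences; elements of
  the other component are actual fields, since its order \<open>m\<close> is nonnegative.\<close>

type_synonym field = "real^3 \<Rightarrow> real^3"

definition A_space :: "(nat \<Rightarrow> real) \<Rightarrow> int \<Rightarrow> (nat \<Rightarrow> real) set" where
  "A_space \<nu> k = {a. summable (\<lambda>j. \<nu> j powi (4 * k) * (a j)\<^sup>2)}"

definition A_norm :: "(nat \<Rightarrow> real) \<Rightarrow> int \<Rightarrow> (nat \<Rightarrow> real) \<Rightarrow> real" where
  "A_norm \<nu> k a = sqrt (\<Sum>j. \<nu> j powi (4 * k) * (a j)\<^sup>2)"

definition W_term ::
    "(real^3) set \<Rightarrow> (nat \<Rightarrow> real) \<Rightarrow> (nat \<Rightarrow> field) \<Rightarrow> (nat \<Rightarrow> field) \<Rightarrow> nat \<Rightarrow> l2 \<Rightarrow> nat \<Rightarrow> real" where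
  "W_term \<Omega> \<mu> qp qm m w j =
     \<mu> j ^ (2 * m) * ((w \<bullet> l2class \<Omega> (qp j))\<^sup>2 + (w \<bullet> l2class \<Omega> (qm j))\<^sup>2)"

definition W_space ::
    "(real^3) set \<Rightarrow> (nat \<Rightarrow> real) \<Rightarrow> (nat \<Rightarrow> field) \<Rightarrow> (nat \<Rightarrow> field) \<Rightarrow> nat \<Rightarrow> l2 set" where
  "W_space \<Omega> \<mu> qp qm m = {w \<in> V0 \<Omega>. summable (W_term \<Omega> \<mu> qp qm m w)}"

definition W_norm ::
    "(real^3) set \<Rightarrow> (nat \<Rightarrow> real) \<Rightarrow> (nat \<Rightarrow> field) \<Rightarrow> (nat \<Rightarrow> field) \<Rightarrow> nat \<Rightarrow> l2 \<Rightarrow> real" where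
  "W_norm \<Omega> \<mu> qp qm m w = sqrt (\<Sum>j. W_term \<Omega> \<mu> qp qm m w j)"

definition C_space :: "(real^3) set \<Rightarrow> (nat \<Rightarrow> real) \<Rightarrow> (nat \<Rightarrow> real) \<Rightarrow> (nat \<Rightarrow> field) \<Rightarrow> (nat \<Rightarrow> field)
    \<Rightarrow> int \<Rightarrow> nat \<Rightarrow> ((nat \<Rightarrow> real) \<times> l2) set" where
  "C_space \<Omega> \<nu> \<mu> qp qm k m = A_space \<nu> k \<times> W_space \<Omega> \<mu> qp qm m"

definition C_dist :: "(real^3) set \<Rightarrow> (nat \<Rightarrow> real) \<Rightarrow> (nat \<Rightarrow> real) \<Rightarrow> (nat \<Rightarrow> field) \<Rightarrow> (nat \<Rightarrow> field)
    \<Rightarrow> int \<Rightarrow> nat \<Rightarrow> (nat \<Rightarrow> real) \<times> l2 \<Rightarrow> (nat \<Rightarrow> real) \<times> l2 \<Rightarrow> real" where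
  "C_dist \<Omega> \<nu> \<mu> qp qm k m u v =
     sqrt ((A_norm \<nu> k (\<lambda>j. fst u j - fst v j))\<^sup>2 + (W_norm \<Omega> \<mu> qp qm m (snd u - snd v))\<^sup>2)"

definition C_topology :: "(real^3) set \<Rightarrow> (nat \<Rightarrow> real) \<Rightarrow> (nat \<Rightarrow> real) \<Rightarrow> (nat \<Rightarrow> field)
    \<Rightarrow> (nat \<Rightarrow> field) \<Rightarrow> int \<Rightarrow> nat \<Rightarrow> ((nat \<Rightarrow> real) \<times> l2) topology" where
  "C_topology \<Omega> \<nu> \<mu> qp qm k m =
     Metric_space.mtopology (C_space \<Omega> \<nu> \<mu> qp qm k m) (C_dist \<Omega> \<nu> \<mu> qp qm k m)"

definition rot_C :: "(real^3) set \<Rightarrow> (nat \<Rightarrow> real) \<times> l2 \<Rightarrow> (nat \<Rightarrow> real) \<times> l2" where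
  "rot_C \<Omega> u = ((\<lambda>_. 0), S_op \<Omega> (snd u))"

definition rot_plus :: "(real^3) set \<Rightarrow> real \<Rightarrow> (nat \<Rightarrow> real) \<times> l2 \<Rightarrow> (nat \<Rightarrow> real) \<times> l2" where
  "rot_plus \<Omega> c u = ((\<lambda>j. fst (rot_C \<Omega> u) j + c * fst u j), snd (rot_C \<Omega> u) + c *\<^sub>R snd u)"

end

theory Submission
  imports Defs "HOL-Computational_Algebra.Polynomial"
begin

text \<open>In the eigenbasis of \<open>S\<close> the operator \<open>rot + c\<close> multiplies coefficients by \<open>\<plusminus>\<mu>\<^sub>j + c\<close>, and it acts as
  multiplication by \<open>c\<close> on the gradient component. The theorem thus amounts to
  \<open>\<delta> \<mu>\<^sub>j \<le> \<bar>\<plusminus>\<mu>\<^sub>j + c\<bar> \<le> K \<mu>\<^sub>j\<close> with \<open>\<delta> > 0\<close>, together with \<open>c \<noteq> 0\<close>. The numbers \<open>\<plusminus>\<mu>\<^sub>j\<close> and \<open>0\<close> lie in the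
  spectrum (for \<open>0\<close>, take the gradient of a bump function), so no factor vanishes, and the lower bound
  follows once the \<open>\<mu>\<^sub>j\<close> are unbounded. No compactness theorem is needed for this: if the \<open>\<mu>\<^sub>j\<close> were
  bounded, then so would be \<open>S\<close>, with domain all of \<open>V0\<close>, which is refuted by the fields
  \<open>rot (\<psi>(x / s) e\<^sub>3)\<close> as \<open>s \<rightarrow> 0\<close>. The domain of \<open>S\<close> is identified in terms of coefficients by
  self-adjointness and Parseval's identity, and surjectivity uses that \<open>L\<^sup>2\<close> is complete.\<close>

section \<open>Hilbert spaces with a paired orthonormal basis\<close>

text \<open>The operator \<open>S + c\<close> degenerates at the eigenvalue \<open>-c\<close>, while
  the hypothesis excludes \<open>c\<close>; the two conditions agree because the eigenvalues come in
  pairs of opposite sign. That no factor vanishes is not yet a bound: a bounded increasing sequence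
  \<open>\<mu> j\<close> could approach \<open>\<bar>c\<bar>\<close> without reaching it, and the
  inverse would then be unbounded. Once the \<open>\<mu> j\<close> are unbounded, the quotients
  \<open>\<bar>\<plusminus>\<mu> j + c\<bar> / \<mu> j\<close> are at least \<open>1 / 2\<close>
  from some index on, and only finitely many remain. The comparison is with \<open>\<mu> j\<close>
  and not with a constant, since this is the weight of the one order by which the two spaces differ
  in the \<open>V0\<close> component. The gradient component is only multiplied by a constant and
  keeps its order. In the scaling argument both the potential
  \<open>\<phi> = \<psi>(x / s) e\<^sub>3\<close> and \<open>w = rot \<phi>\<close> are test fields.
  If \<open>v\<close> is the weak rotation of \<open>w\<close>, testing with \<open>\<phi>\<close>
  gives that the square of the norm of \<open>w\<close> is \<open>v \<bullet> \<phi>\<close>, so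
  \<open>v\<close> never has to be computed. The squared norms of \<open>w\<close> and
  \<open>\<phi>\<close> are of order \<open>s\<close> and \<open>s\<^sup>3\<close>.\<close>

lemma summable_Cauchy_sum_lessThan:
  fixes f :: "nat \<Rightarrow> real"
  assumes "summable f" "0 < e"
  obtains N where "\<And>m n. N \<le> m \<Longrightarrow> sum f {m..<n} < e"
proof -
  from assms(1,2) obtain N where "\<forall>m\<ge>N. \<forall>n. norm (sum f {m..<n}) < e"
    unfolding summable_Cauchy by blast
  then have "sum f {m..<n} < e" if "N \<le> m" for m n
    using that by (metis abs_ge_self order_le_less_trans real_norm_def)
  then show thesis by (rule that)
qed

lemma subspace_closure:
  fixes V :: "'a::real_normed_vector set"
  assumes "subspace V" shows "subspace (closure V)"
  unfolding subspace_def
proof (intro conjI ballI allI)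
  show "0 \<in> closure V"
    using assms closure_subset by (auto simp: subspace_def)
next
  fix x y assume "x \<in> closure V" "y \<in> closure V"
  then obtain f g where "\<And>n. f n \<in> V" "f \<longlonglongrightarrow> x" "\<And>n. g n \<in> V" "g \<longlonglongrightarrow> y"
    unfolding closure_sequential by blast
  then have "\<And>n. f n + g n \<in> V" "(\<lambda>n. f n + g n) \<longlonglongrightarrow> x + y"
    by (auto intro: tendsto_add subspace_add[OF assms])
  then show "x + y \<in> closure V"
    unfolding closure_sequential by (intro exI conjI allI)
next
  fix c :: real and x assume "x \<in> closure V"
  then obtain f where "\<And>n. f n \<in> V" "f \<longlonglongrightarrow> x"
    unfolding closure_sequential by blast
  then have "\<And>n. c *\<^sub>R f n \<in> V" "(\<lambda>n. c *\<^sub>R f n) \<longlonglongrightarrow> c *\<^sub>R x"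
    by (auto intro: tendsto_scaleR subspace_scale[OF assms])
  then show "c *\<^sub>R x \<in> closure V"
    unfolding closure_sequential by (intro exI conjI allI)
qed

text \<open>The sum type that indexes the basis is folded into pairs, so that expansions are
  ordinary series over \<open>nat\<close>, in the shape of \<open>W_term\<close>. \<open>H\<close>
  is a closed subspace rather than the whole type, hence the membership assumptions below.\<close>

locale paired_basis =
  fixes p n :: "nat \<Rightarrow> 'a::{real_inner,complete_space}" and H :: "'a set"
  assumes basis: "orthonormal_basis_of (case_sum p n) H"
begin

lemma orthonormal:
  "p i \<bullet> p j = (if i = j then 1 else 0)" "n i \<bullet> n j = (if i = j then 1 else 0)"
  "p i \<bullet> n j = 0" "n i \<bullet> p j = 0"
proof -
  have o: "case_sum p n i \<bullet> case_sum p n j = (if i = j then 1 else 0)" for i j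
    using basis by (auto simp: orthonormal_basis_of_def)
  show "p i \<bullet> p j = (if i = j then 1 else 0)" "n i \<bullet> n j = (if i = j then 1 else 0)"
    "p i \<bullet> n j = 0" "n i \<bullet> p j = 0"
    using o[of "Inl i" "Inl j"] o[of "Inr i" "Inr j"] o[of "Inl i" "Inr j"] o[of "Inr i" "Inl j"]
    by simp_all
qed

lemma H_eq: "H = closure (span (range (case_sum p n)))"
  using basis by (auto simp: orthonormal_basis_of_def)

lemma closed_H: "closed H"
  by (simp add: H_eq)

lemma subspace_H: "subspace H"
  by (simp add: H_eq subspace_closure)

lemma basis_mem: "p j \<in> H" "n j \<in> H"
proof -
  have "case_sum p n i \<in> H" for i
    unfolding H_eq by (meson closure_subset rangeI span_base subsetD)
  from this[of "Inl j"] this[of "Inr j"] show "p j \<in> H" "n j \<in> H" by simp_all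
qed

definition partial_sum :: "(nat \<Rightarrow> real) \<Rightarrow> (nat \<Rightarrow> real) \<Rightarrow> nat \<Rightarrow> 'a" where
  "partial_sum a b N = (\<Sum>j<N. a j *\<^sub>R p j + b j *\<^sub>R n j)"

lemma partial_sum_mem: "partial_sum a b N \<in> H"
  unfolding partial_sum_def
  by (intro subspace_sum subspace_add subspace_scale subspace_H basis_mem)

lemma inner_partial_sum:
  "w \<bullet> partial_sum a b N = (\<Sum>j<N. a j * (w \<bullet> p j) + b j * (w \<bullet> n j))"
  by (simp add: partial_sum_def inner_sum_right inner_add_right)

lemma partial_sum_coeffs:
  "partial_sum a b N \<bullet> p j = (if j < N then a j else 0)"
  "partial_sum a b N \<bullet> n j = (if j < N then b j else 0)"
proof -
  have "p j \<bullet> partial_sum a b N = (if j < N then a j else 0)"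
    by (simp add: inner_partial_sum orthonormal if_distrib if_distribR cong: if_cong)
  moreover have "n j \<bullet> partial_sum a b N = (if j < N then b j else 0)"
    by (simp add: inner_partial_sum orthonormal if_distrib if_distribR cong: if_cong)
  ultimately show "partial_sum a b N \<bullet> p j = (if j < N then a j else 0)"
    "partial_sum a b N \<bullet> n j = (if j < N then b j else 0)"
    by (simp_all add: inner_commute)
qed

lemma norm_partial_sum_diff:
  assumes "M \<le> N"
  shows "(norm (partial_sum a b N - partial_sum a b M))\<^sup>2 = (\<Sum>j=M..<N. (a j)\<^sup>2 + (b j)\<^sup>2)"
proof -
  let ?f = "\<lambda>j. (a j)\<^sup>2 + (b j)\<^sup>2"
  have "partial_sum a b N \<bullet> partial_sum a b N = sum ?f {..<N}"
    "partial_sum a b M \<bullet> partial_sum a b M = sum ?f {..<M}"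
    "partial_sum a b N \<bullet> partial_sum a b M = sum ?f {..<M}"
    using assms
    by (auto simp: inner_partial_sum partial_sum_coeffs power2_eq_square intro!: sum.cong)
  then have "(norm (partial_sum a b N - partial_sum a b M))\<^sup>2 = sum ?f {..<N} - sum ?f {..<M}"
    by (simp add: power2_norm_eq_inner inner_diff_left inner_diff_right inner_commute)
  also have "\<dots> = sum ?f {M..<N}"
    using assms sum_diff_nat_ivl[of 0 M N ?f] by (simp add: lessThan_atLeast0)
  finally show ?thesis .
qed

text \<open>Orthonormality turns the squared distance of two partial sums into a block of the given
  series, so they form a Cauchy sequence; continuity of the inner product then reads off the
  coefficients of the limit.\<close>

lemma Riesz_Fischer:
  assumes "summable (\<lambda>j. (a j)\<^sup>2 + (b j)\<^sup>2)"
  obtains w where "w \<in> H" "partial_sum a b \<longlonglongrightarrow> w" "\<And>j. w \<bullet> p j = a j" "\<And>j. w \<bullet> n j = b j"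
proof -
  have "Cauchy (partial_sum a b)"
  proof (rule CauchyI')
    fix e :: real assume "0 < e"
    then obtain N where N: "\<And>m n. N \<le> m \<Longrightarrow> (\<Sum>j=m..<n. (a j)\<^sup>2 + (b j)\<^sup>2) < e\<^sup>2"
      using summable_Cauchy_sum_lessThan[OF assms zero_less_power[OF \<open>0 < e\<close>, of 2]] by blast
    have "dist (partial_sum a b m) (partial_sum a b k) < e" if "N \<le> m" "m < k" for m k
    proof -
      have "(norm (partial_sum a b k - partial_sum a b m))\<^sup>2 < e\<^sup>2"
        using N[of m k] that by (simp add: norm_partial_sum_diff)
      then show ?thesis
        using \<open>0 < e\<close> by (simp add: dist_norm norm_minus_commute power_less_imp_less_base)
    qed
    then show "\<exists>M. \<forall>m\<ge>M. \<forall>k>m. dist (partial_sum a b m) (partial_sum a b k) < e"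
      by blast
  qed
  then obtain w where w: "partial_sum a b \<longlonglongrightarrow> w"
    using Cauchy_convergent_iff convergent_def by blast
  have "w \<in> H"
    using closed_sequentially[OF closed_H _ w] partial_sum_mem by blast
  moreover have "w \<bullet> p j = a j" for j
  proof (rule LIMSEQ_unique)
    show "(\<lambda>N. partial_sum a b N \<bullet> p j) \<longlonglongrightarrow> w \<bullet> p j"
      by (intro tendsto_intros w)
    show "(\<lambda>N. partial_sum a b N \<bullet> p j) \<longlonglongrightarrow> a j"
      by (rule tendsto_eventually, rule eventually_mono[OF eventually_gt_at_top[of j]])
        (simp add: partial_sum_coeffs)
  qed
  moreover have "w \<bullet> n j = b j" for j
  proof (rule LIMSEQ_unique)
    show "(\<lambda>N. partial_sum a b N \<bullet> n j) \<longlonglongrightarrow> w \<bullet> n j"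
      by (intro tendsto_intros w)
    show "(\<lambda>N. partial_sum a b N \<bullet> n j) \<longlonglongrightarrow> b j"
      by (rule tendsto_eventually, rule eventually_mono[OF eventually_gt_at_top[of j]])
        (simp add: partial_sum_coeffs)
  qed
  ultimately show thesis by (intro that[OF _ w])
qed

text \<open>The vectors orthogonal to \<open>w\<close> form a closed subspace. It contains the
  basis, hence all of \<open>H\<close>, and in particular \<open>w\<close> itself.\<close>

lemma zero_if_coeffs_zero:
  assumes "w \<in> H" "\<And>j. w \<bullet> p j = 0" "\<And>j. w \<bullet> n j = 0"
  shows "w = 0"
proof -
  have "closed {v. w \<bullet> v = 0}"
    by (intro closed_Collect_eq continuous_intros)
  moreover have "range (case_sum p n) \<subseteq> {v. w \<bullet> v = 0}"
    using assms(2,3) by (auto split: sum.splits)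
  then have "span (range (case_sum p n)) \<subseteq> {v. w \<bullet> v = 0}"
    by (rule span_minimal) (auto simp: subspace_def inner_add_right)
  ultimately have "H \<subseteq> {v. w \<bullet> v = 0}"
    unfolding H_eq by (rule closure_minimal[rotated])
  with assms(1) show ?thesis by auto
qed

lemma eq_if_coeffs_eq:
  assumes "v \<in> H" "w \<in> H" "\<And>j. v \<bullet> p j = w \<bullet> p j" "\<And>j. v \<bullet> n j = w \<bullet> n j"
  shows "v = w"
  using zero_if_coeffs_zero[of "v - w"] assms subspace_diff[OF subspace_H]
  by (auto simp: inner_diff_left)

lemma Bessel: "summable (\<lambda>j. (w \<bullet> p j)\<^sup>2 + (w \<bullet> n j)\<^sup>2)"
proof (rule summableI_nonneg_bounded)
  fix N
  let ?s = "partial_sum (\<lambda>j. w \<bullet> p j) (\<lambda>j. w \<bullet> n j) N"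
  let ?S = "\<Sum>j<N. (w \<bullet> p j)\<^sup>2 + (w \<bullet> n j)\<^sup>2"
  have "w \<bullet> ?s = ?S" "?s \<bullet> ?s = ?S"
    by (simp_all add: inner_partial_sum partial_sum_coeffs power2_eq_square)
  moreover have "0 \<le> (w - ?s) \<bullet> (w - ?s)" by simp
  ultimately show "?S \<le> w \<bullet> w"
    by (simp add: inner_diff_left inner_diff_right inner_commute)
qed simp

text \<open>Bessel's inequality makes the expansion converge to some element of \<open>H\<close>,
  and that limit has the same coefficients as \<open>w\<close>.\<close>

lemma partial_sum_tendsto:
  assumes "w \<in> H"
  shows "partial_sum (\<lambda>j. w \<bullet> p j) (\<lambda>j. w \<bullet> n j) \<longlonglongrightarrow> w"
proof -
  obtain v where v: "v \<in> H" "partial_sum (\<lambda>j. w \<bullet> p j) (\<lambda>j. w \<bullet> n j) \<longlonglongrightarrow> v"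
    "\<And>j. v \<bullet> p j = w \<bullet> p j" "\<And>j. v \<bullet> n j = w \<bullet> n j"
    using Riesz_Fischer[OF Bessel[of w]] by metis
  moreover have "v = w"
    by (rule eq_if_coeffs_eq) (use v assms in auto)
  ultimately show ?thesis by simp
qed

lemma Parseval:
  assumes "w \<in> H"
  shows "(\<lambda>j. (w \<bullet> p j) * (v \<bullet> p j) + (w \<bullet> n j) * (v \<bullet> n j)) sums (v \<bullet> w)"
proof -
  have "(\<lambda>N. v \<bullet> partial_sum (\<lambda>j. w \<bullet> p j) (\<lambda>j. w \<bullet> n j) N) \<longlonglongrightarrow> v \<bullet> w"
    by (intro tendsto_intros partial_sum_tendsto assms)
  then show ?thesis
    by (simp add: inner_partial_sum sums_def)
qed

end

section \<open>Self-adjoint operators that are diagonal in the paired basis\<close>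

locale diagonal_self_adjoint = paired_basis p n H
  for p n :: "nat \<Rightarrow> 'a::{real_inner,complete_space}" and H +
  fixes T :: "('a \<times> 'a) set" and \<mu> :: "nat \<Rightarrow> real"
  assumes self_adjoint: "self_adjoint_in H T"
    and eigen: "\<And>j. (p j, \<mu> j *\<^sub>R p j) \<in> T" "\<And>j. (n j, - \<mu> j *\<^sub>R n j) \<in> T"
begin

lemma T_adjoint: "(u, v) \<in> T \<longleftrightarrow> u \<in> H \<and> v \<in> H \<and> (\<forall>(f, g)\<in>T. g \<bullet> u = f \<bullet> v)"
proof -
  have "T = {(u, v). u \<in> H \<and> v \<in> H \<and> (\<forall>(f, g)\<in>T. g \<bullet> u = f \<bullet> v)}"
    using self_adjoint unfolding self_adjoint_in_def by (elim conjE)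
  then have "(u, v) \<in> T \<longleftrightarrow> (u, v) \<in> {(u, v). u \<in> H \<and> v \<in> H \<and> (\<forall>(f, g)\<in>T. g \<bullet> u = f \<bullet> v)}"
    by (rule arg_cong)
  then show ?thesis by (simp only: mem_Collect_eq prod.case)
qed

text \<open>Testing a pair of the graph against the eigenpairs yields the coefficients. Conversely,
  maximality enters: a pair with the right coefficients satisfies the adjoint relation against every
  \<open>(f, g)\<close> in \<open>T\<close>, and self-adjointness puts it back into
  \<open>T\<close>. For a merely symmetric operator the domain could be smaller.\<close>

lemma mem_T_iff:
  "(w, v) \<in> T \<longleftrightarrow> w \<in> H \<and> v \<in> H \<and>
     (\<forall>j. v \<bullet> p j = \<mu> j * (w \<bullet> p j)) \<and> (\<forall>j. v \<bullet> n j = - \<mu> j * (w \<bullet> n j))"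
proof -
  have coeffs: "v \<bullet> p j = \<mu> j * (w \<bullet> p j)" "v \<bullet> n j = - \<mu> j * (w \<bullet> n j)" if "(w, v) \<in> T" for w v j
  proof -
    have "(\<mu> j *\<^sub>R p j) \<bullet> w = p j \<bullet> v" "(- \<mu> j *\<^sub>R n j) \<bullet> w = n j \<bullet> v"
      using that eigen[of j] unfolding T_adjoint[of w v] by auto
    then show "v \<bullet> p j = \<mu> j * (w \<bullet> p j)" "v \<bullet> n j = - \<mu> j * (w \<bullet> n j)"
      by (simp_all add: inner_commute)
  qed
  have "(w, v) \<in> T" if wv: "w \<in> H" "v \<in> H" "\<And>j. v \<bullet> p j = \<mu> j * (w \<bullet> p j)"
    "\<And>j. v \<bullet> n j = - \<mu> j * (w \<bullet> n j)"
  proof -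
    have "g \<bullet> w = f \<bullet> v" if "(f, g) \<in> T" for f g
    proof (rule sums_unique2)
      show "(\<lambda>j. (w \<bullet> p j) * (g \<bullet> p j) + (w \<bullet> n j) * (g \<bullet> n j)) sums (g \<bullet> w)"
        by (rule Parseval[OF wv(1)])
      \<comment> \<open>Both inner products expand into the same series: the factor
        \<open>\<plusminus>\<mu> j\<close> comes from \<open>g\<close> in the one and from
        \<open>v\<close> in the other.\<close>
      show "(\<lambda>j. (w \<bullet> p j) * (g \<bullet> p j) + (w \<bullet> n j) * (g \<bullet> n j)) sums (f \<bullet> v)"
        using Parseval[OF wv(2), of f] by (simp add: wv(3,4) coeffs[OF that] mult_ac)
    qed
    then show ?thesis using wv by (auto simp: T_adjoint)
  qed
  then show ?thesis using coeffs by (auto simp: T_adjoint)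
qed

lemma T_unique: "(w, v) \<in> T \<Longrightarrow> (w, v') \<in> T \<Longrightarrow> v = v'"
  by (rule eq_if_coeffs_eq) (auto simp: mem_T_iff)

lemma mem_T_exists:
  assumes "w \<in> H" "summable (\<lambda>j. (\<mu> j)\<^sup>2 * ((w \<bullet> p j)\<^sup>2 + (w \<bullet> n j)\<^sup>2))"
  shows "\<exists>v. (w, v) \<in> T"
proof -
  have "summable (\<lambda>j. (\<mu> j * (w \<bullet> p j))\<^sup>2 + (- \<mu> j * (w \<bullet> n j))\<^sup>2)"
    using assms(2) by (simp add: power_mult_distrib distrib_left)
  then obtain v where "v \<in> H" "\<And>j. v \<bullet> p j = \<mu> j * (w \<bullet> p j)" "\<And>j. v \<bullet> n j = - \<mu> j * (w \<bullet> n j)"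
    by (rule Riesz_Fischer) simp
  then show ?thesis
    using assms(1) by (auto simp: mem_T_iff)
qed

text \<open>With bounded eigenvalues the summability condition of \<open>mem_T_exists\<close>
  follows from Bessel's inequality for every \<open>w\<close>, so the domain is all of
  \<open>H\<close>; Parseval's identity then gives the operator bound.\<close>

lemma bounded_if_eigenvalues_bounded:
  assumes M: "\<And>j. \<bar>\<mu> j\<bar> \<le> M" and w: "w \<in> H"
  obtains v where "(w, v) \<in> T" "norm v \<le> M * norm w"
proof -
  have le: "(\<mu> j)\<^sup>2 * ((w \<bullet> p j)\<^sup>2 + (w \<bullet> n j)\<^sup>2) \<le> M\<^sup>2 * ((w \<bullet> p j)\<^sup>2 + (w \<bullet> n j)\<^sup>2)" for j
    using M[of j] abs_le_square_iff[of "\<mu> j" M] by (intro mult_right_mono) auto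
  have "summable (\<lambda>j. (\<mu> j)\<^sup>2 * ((w \<bullet> p j)\<^sup>2 + (w \<bullet> n j)\<^sup>2))"
    by (rule summable_comparison_test'[OF summable_mult[OF Bessel[of w], of "M\<^sup>2"], of 0])
      (use le in \<open>simp add: abs_mult\<close>)
  with w obtain v where v: "(w, v) \<in> T"
    using mem_T_exists by blast
  have "v \<bullet> v \<le> M\<^sup>2 * (w \<bullet> w)"
  proof (rule sums_le)
    show "(\<lambda>j. (v \<bullet> p j) * (v \<bullet> p j) + (v \<bullet> n j) * (v \<bullet> n j)) sums (v \<bullet> v)"
      using v by (intro Parseval) (simp add: mem_T_iff)
    show "(\<lambda>j. M\<^sup>2 * ((w \<bullet> p j) * (w \<bullet> p j) + (w \<bullet> n j) * (w \<bullet> n j))) sums (M\<^sup>2 * (w \<bullet> w))"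
      by (intro sums_mult Parseval w)
    show "(v \<bullet> p j) * (v \<bullet> p j) + (v \<bullet> n j) * (v \<bullet> n j)
        \<le> M\<^sup>2 * ((w \<bullet> p j) * (w \<bullet> p j) + (w \<bullet> n j) * (w \<bullet> n j))" for j
      using v le[of j] by (simp add: mem_T_iff power2_eq_square algebra_simps)
  qed
  then have "(norm v)\<^sup>2 \<le> (M * norm w)\<^sup>2"
    by (simp add: power2_norm_eq_inner power_mult_distrib)
  moreover have "0 \<le> M"
    using M[of 0] by linarith
  ultimately have "norm v \<le> M * norm w"
    using power2_le_imp_le[of "norm v" "M * norm w"] by simp
  with v show thesis by (rule that)
qed

end

section \<open>Completeness of the space of square integrable fields\<close>

text \<open>This is \<open>l2class UNIV\<close>, a total name for the class of a field on the whole
  space, with junk value 0.\<close>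

lift_definition of_field :: "(real^3 \<Rightarrow> real^3) \<Rightarrow> l2" is
  "\<lambda>f. if sq_integrable f then f else (\<lambda>_. 0)"
  by (auto simp: sq_integrable_zero)

lemma of_field_surj: obtains f where "sq_integrable f" "F = of_field f"
proof -
  have "\<exists>f. sq_integrable f \<and> F = of_field f"
    by transfer auto
  then show thesis using that by blast
qed

lemma of_field_diff:
  assumes "sq_integrable f" "sq_integrable g"
  shows "of_field f - of_field g = of_field (\<lambda>x. f x - g x)"
  using assms unfolding minus_l2_def
  by transfer (auto simp: sq_integrable_add sq_integrable_minus
      dest: sq_integrable_add[OF _ sq_integrable_minus])

lemma norm_of_field:
  assumes "sq_integrable f"
  shows "(norm (of_field f))\<^sup>2 = (LINT x|lborel. (norm (f x))\<^sup>2)"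
proof -
  have "of_field f \<bullet> of_field f = (LINT x|lborel. f x \<bullet> f x)"
    using assms by transfer auto
  then show ?thesis by (simp add: power2_norm_eq_inner)
qed

lemma nn_integral_of_field:
  assumes "sq_integrable f"
  shows "(\<integral>\<^sup>+x. ennreal ((norm (f x))\<^sup>2) \<partial>lborel) = ennreal ((norm (of_field f))\<^sup>2)"
  using assms by (subst norm_of_field[OF assms], intro nn_integral_eq_integral)
    (auto simp: sq_integrable_def)

lemma sq_integrable_iff_nn_integral:
  "sq_integrable f \<longleftrightarrow>
     f \<in> borel_measurable lborel \<and> (\<integral>\<^sup>+x. ennreal ((norm (f x))\<^sup>2) \<partial>lborel) < \<infinity>"
  unfolding sq_integrable_def
  by (auto simp: integrable_iff_bounded)

lemma sq_integrable_diff: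
  "sq_integrable f \<Longrightarrow> sq_integrable g \<Longrightarrow> sq_integrable (\<lambda>x. f x - g x)"
  using sq_integrable_add[OF _ sq_integrable_minus] by force

text \<open>The increments \<open>d\<close> along a rapidly convergent subsequence are summable almost everywhere,
  because \<open>d \<le> 2\<^sup>-\<^sup>k + 2\<^sup>k d\<^sup>2\<close> and the squares are controlled by monotone convergence.\<close>

lemma AE_convergent_if_rapidly_Cauchy:
  assumes f: "\<And>k. sq_integrable (f k)"
    and rapid: "\<And>k. norm (of_field (f (Suc k)) - of_field (f k)) \<le> (1/2) ^ k"
  shows "AE x in lborel. convergent (\<lambda>k. f k x)"
proof -
  let ?d = "\<lambda>k x. norm (f (Suc k) x - f k x)"
  have [measurable]: "f k \<in> borel_measurable lborel" for k
    using f by (simp add: sq_integrable_def)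
  have "(\<integral>\<^sup>+x. (\<Sum>k. ennreal (2 ^ k * (?d k x)\<^sup>2)) \<partial>lborel)
      = (\<Sum>k. \<integral>\<^sup>+x. ennreal (2 ^ k * (?d k x)\<^sup>2) \<partial>lborel)"
    by (rule nn_integral_suminf) simp
  also have "\<dots> \<le> (\<Sum>k. ennreal ((1/2) ^ k))"
  proof (rule suminf_le)
    fix k
    have "(\<integral>\<^sup>+x. ennreal (2 ^ k * (?d k x)\<^sup>2) \<partial>lborel)
        = ennreal (2 ^ k) * (\<integral>\<^sup>+x. ennreal ((?d k x)\<^sup>2) \<partial>lborel)"
      by (subst nn_integral_cmult[symmetric]) (auto simp: ennreal_mult)
    also have "\<dots> = ennreal (2 ^ k * (norm (of_field (f (Suc k)) - of_field (f k)))\<^sup>2)"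
      by (simp add: of_field_diff f nn_integral_of_field sq_integrable_diff ennreal_mult)
    also have "\<dots> \<le> ennreal (2 ^ k * ((1/2) ^ k)\<^sup>2)"
      by (intro ennreal_leI mult_left_mono power_mono rapid) auto
    also have "2 ^ k * ((1/2) ^ k)\<^sup>2 = ((1/2) ^ k :: real)"
      by (simp add: power2_eq_square power_divide)
    finally show "(\<integral>\<^sup>+x. ennreal (2 ^ k * (?d k x)\<^sup>2) \<partial>lborel) \<le> ennreal ((1/2) ^ k)" .
  qed auto
  also have "\<dots> = ennreal (\<Sum>k. (1/2) ^ k)"
    by (rule suminf_ennreal2) auto
  finally have "(\<integral>\<^sup>+x. (\<Sum>k. ennreal (2 ^ k * (?d k x)\<^sup>2)) \<partial>lborel) \<noteq> \<infinity>"
    by (metis ennreal_less_top infinity_ennreal_def leD)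
  then have "AE x in lborel. (\<Sum>k. ennreal (2 ^ k * (?d k x)\<^sup>2)) \<noteq> \<infinity>"
    by (intro nn_integral_PInf_AE) auto
  then show ?thesis
  proof (rule AE_mp, intro AE_I2 impI)
    fix x assume fin: "(\<Sum>k. ennreal (2 ^ k * (?d k x)\<^sup>2)) \<noteq> \<infinity>"
    have sq: "summable (\<lambda>k. 2 ^ k * (?d k x)\<^sup>2)"
      by (rule summable_suminf_not_top) (use fin in auto)
    have "summable (\<lambda>k. norm (f (Suc k) x - f k x))"
    proof (rule summable_comparison_test')
      show "summable (\<lambda>k. (1/2) ^ k + 2 ^ k * (?d k x)\<^sup>2)"
        by (intro summable_add sq) auto
      show "norm (?d k x) \<le> (1/2) ^ k + 2 ^ k * (?d k x)\<^sup>2" for k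
      proof (cases "?d k x \<le> (1/2) ^ k")
        case True
        then show ?thesis by (simp add: add_increasing2)
      next
        case False
        then have "1 \<le> 2 ^ k * ?d k x"
          by (simp add: field_simps power_divide)
        then have "?d k x \<le> 2 ^ k * ?d k x * ?d k x"
          by (simp add: mult_le_cancel_right1)
        then show ?thesis
          by (simp add: power2_eq_square mult.assoc add_increasing)
      qed
    qed
    then have "summable (\<lambda>k. f (Suc k) x - f k x)"
      by (rule summable_norm_cancel)
    then have "convergent (\<lambda>n. \<Sum>k<n. f (Suc k) x - f k x)"
      by (simp add: summable_iff_convergent)
    then have "convergent (\<lambda>n. f n x - f 0 x)"
      by (simp only: sum_lessThan_telescope[of "\<lambda>k. f k x"])
    then show "convergent (\<lambda>n. f n x)"
      using convergent_add[OF _ convergent_const[of "f 0 x"]] by force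
  qed
qed

text \<open>The limit is found pointwise along a rapidly convergent subsequence. Fatou's lemma then
  carries the Cauchy estimate over to the distance between the limit and any late term, so the whole
  sequence converges and not only the subsequence.\<close>

lemma Cauchy_l2_convergent:
  fixes X :: "nat \<Rightarrow> l2"
  assumes "Cauchy X"
  shows "convergent X"
proof -
  \<comment> \<open>Each \<open>r k\<close> is a threshold for \<open>(1/2) ^ k\<close>, so the term
    at \<open>r (Suc k)\<close> is automatically that close to the one at
    \<open>r k\<close>.\<close>
  have "\<exists>r. strict_mono (r :: nat \<Rightarrow> nat) \<and> (\<forall>k. \<forall>n\<ge>r k. norm (X n - X (r k)) < (1/2) ^ k)"
  proof (rule dependent_nat_choice[where P = "\<lambda>k x. \<forall>n\<ge>x. norm (X n - X x) < (1/2) ^ k"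
        and Q = "\<lambda>_ x y. x < y", folded strict_mono_Suc_iff, THEN exE])
    fix k
    show "\<exists>x. \<forall>n\<ge>x. norm (X n - X x) < (1/2) ^ (0::nat)"
      using CauchyD[OF assms, of 1] by auto
  next
    fix x k :: nat
    obtain M where M: "\<And>m n. m \<ge> M \<Longrightarrow> n \<ge> M \<Longrightarrow> norm (X m - X n) < (1/2) ^ Suc k"
      using CauchyD[OF assms, of "(1/2) ^ Suc k"] by auto
    show "\<exists>y. (\<forall>n\<ge>y. norm (X n - X y) < (1/2) ^ Suc k) \<and> x < y"
      by (rule exI[of _ "max M (Suc x)"], intro conjI allI impI M) auto
  qed (auto simp: strict_mono_Suc_iff)
  then obtain r :: "nat \<Rightarrow> nat" where r: "strict_mono r"
    and near: "\<And>k n. r k \<le> n \<Longrightarrow> norm (X n - X (r k)) < (1/2) ^ k"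
    by blast
  have "\<forall>n. \<exists>f. sq_integrable f \<and> X n = of_field f"
    by (metis of_field_surj)
  then obtain f where f: "\<And>n. sq_integrable (f n)" and X: "\<And>n. X n = of_field (f n)"
    by metis
  have [measurable]: "f k \<in> borel_measurable lborel" for k
    using f by (simp add: sq_integrable_def)
  have conv: "AE x in lborel. convergent (\<lambda>k. f (r k) x)"
  proof (rule AE_convergent_if_rapidly_Cauchy)
    show "norm (of_field (f (r (Suc k))) - of_field (f (r k))) \<le> (1/2) ^ k" for k
      using near[of k "r (Suc k)"] r by (simp add: X strict_mono_def less_imp_le)
  qed (rule f)
  define g where "g x = (if convergent (\<lambda>k. f (r k) x) then lim (\<lambda>k. f (r k) x) else 0)" for x
  have [measurable]: "g \<in> borel_measurable lborel"
    unfolding g_def Cauchy_convergent_iff[symmetric] by measurable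
  have lim: "AE x in lborel. (\<lambda>k. f (r k) x) \<longlonglongrightarrow> g x"
    using conv by (rule AE_mp) (simp add: g_def convergent_LIMSEQ_iff)
  \<comment> \<open>Here \<open>n\<close> is fixed while the other index runs to infinity along
    \<open>r\<close>.\<close>
  have Fatou: "(\<integral>\<^sup>+x. ennreal ((norm (g x - f n x))\<^sup>2) \<partial>lborel) \<le> ennreal (e\<^sup>2)"
    if e: "0 < e" and N: "\<And>m. N \<le> m \<Longrightarrow> norm (X m - X n) \<le> e" for n N e
  proof -
    have "(\<integral>\<^sup>+x. ennreal ((norm (g x - f n x))\<^sup>2) \<partial>lborel)
        = (\<integral>\<^sup>+x. liminf (\<lambda>k. ennreal ((norm (f (r k) x - f n x))\<^sup>2)) \<partial>lborel)"
    proof (rule nn_integral_cong_AE, use lim in \<open>rule AE_mp\<close>, intro AE_I2 impI)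
      fix x assume "(\<lambda>k. f (r k) x) \<longlonglongrightarrow> g x"
      then have "(\<lambda>k. ennreal ((norm (f (r k) x - f n x))\<^sup>2)) \<longlonglongrightarrow> ennreal ((norm (g x - f n x))\<^sup>2)"
        by (intro tendsto_intros)
      then show "ennreal ((norm (g x - f n x))\<^sup>2) = liminf (\<lambda>k. ennreal ((norm (f (r k) x - f n x))\<^sup>2))"
        by (rule lim_imp_Liminf[OF trivial_limit_sequentially, symmetric])
    qed
    also have "\<dots> \<le> liminf (\<lambda>k. \<integral>\<^sup>+x. ennreal ((norm (f (r k) x - f n x))\<^sup>2) \<partial>lborel)"
      by (rule nn_integral_liminf) simp
    also have "\<dots> = liminf (\<lambda>k. ennreal ((norm (X (r k) - X n))\<^sup>2))"
      by (simp add: X of_field_diff f nn_integral_of_field sq_integrable_diff)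
    also have "\<dots> \<le> ennreal (e\<^sup>2)"
    proof (rule Liminf_le)
      show "\<forall>\<^sub>F k in sequentially. ennreal ((norm (X (r k) - X n))\<^sup>2) \<le> ennreal (e\<^sup>2)"
      proof (rule eventually_sequentiallyI[of N])
        fix k assume "N \<le> k"
        then have "N \<le> r k"
          using seq_suble[OF r, of k] by linarith
        then show "ennreal ((norm (X (r k) - X n))\<^sup>2) \<le> ennreal (e\<^sup>2)"
          by (intro ennreal_leI power_mono N) auto
      qed
    qed simp
    finally show ?thesis .
  qed
  have Cauchy_le: "\<exists>N. \<forall>m\<ge>N. \<forall>n\<ge>N. norm (X m - X n) \<le> e" if "0 < e" for e
    using CauchyD[OF assms that] by (meson less_imp_le)
  obtain N where N: "\<And>m n. N \<le> m \<Longrightarrow> N \<le> n \<Longrightarrow> norm (X m - X n) \<le> 1"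
    using Cauchy_le[of 1] by auto
  \<comment> \<open>Fatou's lemma controls only differences, so square integrability of
    \<open>g\<close> is recovered by adding \<open>f N\<close> back.\<close>
  have "sq_integrable (\<lambda>x. g x - f N x)"
    using Fatou[of 1 N N] N by (auto simp: sq_integrable_iff_nn_integral intro: le_less_trans)
  from sq_integrable_add[OF this f[of N]] have g: "sq_integrable g"
    by simp
  have "X \<longlonglongrightarrow> of_field g"
  proof (rule LIMSEQ_I)
    fix e :: real assume e: "0 < e"
    obtain M where M: "\<And>m n. M \<le> m \<Longrightarrow> M \<le> n \<Longrightarrow> norm (X m - X n) \<le> e / 2"
      using Cauchy_le[of "e / 2"] e by auto
    have "norm (X n - of_field g) < e" if "M \<le> n" for n
    proof -
      have "ennreal ((norm (of_field g - X n))\<^sup>2) \<le> ennreal ((e / 2)\<^sup>2)"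
        using Fatou[of "e / 2" M n] M that e
        by (simp add: X of_field_diff f g nn_integral_of_field sq_integrable_diff)
      then have "(norm (of_field g - X n))\<^sup>2 \<le> (e / 2)\<^sup>2"
        by (subst (asm) ennreal_le_iff) auto
      then have "norm (of_field g - X n) \<le> e / 2"
        by (rule power2_le_imp_le) (use e in auto)
      then show ?thesis
        using e by (simp add: norm_minus_commute)
    qed
    then show "\<exists>M. \<forall>n\<ge>M. norm (X n - of_field g) < e"
      by blast
  qed
  then show ?thesis
    by (rule convergentI)
qed

instance l2 :: complete_space
  by standard (rule Cauchy_l2_convergent)

section \<open>Calculus of continuously differentiable functions\<close>

lemma Ck_subset: "Ck n S f \<Longrightarrow> S' \<subseteq> S \<Longrightarrow> Ck n S' f"
  by (induction n arbitrary: f) (auto intro: continuous_on_subset)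

lemma Ck_cong:
  assumes "open S" "\<And>x. x \<in> S \<Longrightarrow> f x = g x" "Ck n S f"
  shows "Ck n S g"
  using assms(2,3)
proof (induction n arbitrary: f g)
  case 0
  then show ?case by (simp cong: continuous_on_cong)
next
  case (Suc n)
  have D: "(g has_derivative frechet_derivative f (at x)) (at x)" if "x \<in> S" for x
  proof (rule has_derivative_transform_within_open[OF _ \<open>open S\<close> that])
    show "(f has_derivative frechet_derivative f (at x)) (at x)"
      using Suc.prems(2) that by (simp add: frechet_derivative_works)
  qed (use Suc.prems(1) in auto)
  then have "frechet_derivative g (at x) = frechet_derivative f (at x)" if "x \<in> S" for x
    using that frechet_derivative_at by metis
  moreover have "g differentiable (at x)" if "x \<in> S" for x
    using D[OF that] by (rule differentiableI)
  ultimately show ?case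
    using Suc.prems(2) by (auto intro: Suc.IH[rotated])
qed

lemma Ck_SucI:
  assumes "open S" "\<And>x. x \<in> S \<Longrightarrow> (f has_derivative D x) (at x)"
    "\<And>b. b \<in> Basis \<Longrightarrow> Ck n S (\<lambda>x. D x b)"
  shows "Ck (Suc n) S f"
proof -
  have "f differentiable (at x)" if "x \<in> S" for x
    using assms(2)[OF that] by (rule differentiableI)
  moreover have "Ck n S (\<lambda>x. frechet_derivative f (at x) b)" if "b \<in> Basis" for b
    by (rule Ck_cong[OF \<open>open S\<close> _ assms(3)[OF that]])
      (use frechet_derivative_at[OF assms(2)] in auto)
  ultimately show ?thesis by simp
qed

lemma Ck_SucD:
  assumes "Ck (Suc n) S f"
  shows "x \<in> S \<Longrightarrow> (f has_derivative frechet_derivative f (at x)) (at x)"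
    and "b \<in> Basis \<Longrightarrow> Ck n S (\<lambda>x. frechet_derivative f (at x) b)"
  using assms by (auto simp: frechet_derivative_works)

text \<open>\<open>Ck (Suc n)\<close> does not list continuity of \<open>f\<close> itself; the base
  case obtains it from differentiability.\<close>

lemma Ck_Suc_imp_Ck: "Ck (Suc n) S f \<Longrightarrow> Ck n S f"
proof (induction n arbitrary: f)
  case 0
  then show ?case
    by (auto intro!: continuous_at_imp_continuous_on differentiable_imp_continuous_within)
next
  case (Suc n)
  then show ?case by simp
qed

lemma Ck_continuous_on: "Ck n S f \<Longrightarrow> continuous_on S f"
  by (induction n) (use Ck_Suc_imp_Ck in auto)

lemma Ck_const: "Ck n S (\<lambda>x. c)"
  by (induction n arbitrary: c) auto

lemma Ck_add:
  assumes "open S" "Ck n S f" "Ck n S g"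
  shows "Ck n S (\<lambda>x. f x + g x)"
  using assms(2,3)
proof (induction n arbitrary: f g)
  case (Suc n)
  show ?case
    by (rule Ck_SucI[OF \<open>open S\<close> has_derivative_add[OF Ck_SucD(1)[OF Suc.prems(1)] Ck_SucD(1)[OF Suc.prems(2)]]])
      (assumption | intro Suc.IH Ck_SucD(2)[OF Suc.prems(1)] Ck_SucD(2)[OF Suc.prems(2)])+
qed (auto intro: continuous_intros)

lemma Ck_bounded_linear:
  assumes "open S" "bounded_linear L" "Ck n S f"
  shows "Ck n S (\<lambda>x. L (f x))"
  using assms(3)
proof (induction n arbitrary: f)
  case 0
  then show ?case by (auto intro: bounded_linear.continuous_on[OF assms(2)])
next
  case (Suc n)
  show ?case
    by (rule Ck_SucI[OF \<open>open S\<close> bounded_linear.has_derivative[OF assms(2) Ck_SucD(1)[OF Suc.prems]]])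
      (assumption | intro Suc.IH Ck_SucD(2)[OF Suc.prems])+
qed

lemma Ck_mult:
  fixes f g :: "'a::euclidean_space \<Rightarrow> real"
  assumes "open S" "Ck n S f" "Ck n S g"
  shows "Ck n S (\<lambda>x. f x * g x)"
  using assms(2,3)
proof (induction n arbitrary: f g)
  case (Suc n)
  show ?case
    by (rule Ck_SucI[OF \<open>open S\<close> has_derivative_mult[OF Ck_SucD(1)[OF Suc.prems(1)] Ck_SucD(1)[OF Suc.prems(2)]]])
      (assumption | intro Ck_add[OF \<open>open S\<close>] Suc.IH Ck_SucD(2)[OF Suc.prems(1)] Ck_SucD(2)[OF Suc.prems(2)]
        Ck_Suc_imp_Ck[OF Suc.prems(1)] Ck_Suc_imp_Ck[OF Suc.prems(2)])+
qed (auto intro: continuous_intros)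

text \<open>For an affine inner function a directional derivative has the same form again, a
  constant times the derivative of \<open>f\<close> composed with the same inner function. The
  induction therefore closes without a chain rule of order \<open>n\<close> for general
  maps.\<close>

lemma Ck_compose_functional:
  fixes f :: "real \<Rightarrow> real" and L :: "'a::euclidean_space \<Rightarrow> real"
  assumes "bounded_linear L" "Ck n UNIV f"
  shows "Ck n UNIV (\<lambda>x. f (L x + t))"
  using assms(2)
proof (induction n arbitrary: f)
  case 0
  then show ?case
    using continuous_on_compose2[of UNIV f UNIV "\<lambda>x. L x + t"]
    by (simp add: continuous_on_add linear_continuous_on[OF assms(1)])
next
  case (Suc n)
  have "((\<lambda>x. f (L x + t)) has_derivative (\<lambda>b. frechet_derivative f (at (L x + t)) (L b))) (at x)" for x
    by (rule has_derivative_compose[of "\<lambda>x. L x + t" L x UNIV f])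
      (auto intro!: derivative_eq_intros bounded_linear_imp_has_derivative[OF assms(1)]
        Ck_SucD(1)[OF Suc.prems])
  moreover have "frechet_derivative f (at s) (L b) = L b * frechet_derivative f (at s) 1" for s b
  proof -
    have "linear (frechet_derivative f (at s))"
      using Suc.prems by (intro linear_frechet_derivative) auto
    from linear_scale[OF this, of "L b" 1] show ?thesis by simp
  qed
  ultimately have "((\<lambda>x. f (L x + t)) has_derivative
      (\<lambda>b. L b * frechet_derivative f (at (L x + t)) 1)) (at x)" for x
    by simp
  then show ?case
  proof (rule Ck_SucI[OF open_UNIV])
    have "Ck n UNIV (\<lambda>x. frechet_derivative f (at (L x + t)) 1)"
      by (rule Suc.IH) (use Ck_SucD(2)[OF Suc.prems] in auto)
    then show "Ck n UNIV (\<lambda>x. L b * frechet_derivative f (at (L x + t)) 1)" for b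
      by (intro Ck_mult Ck_const) auto
  qed
qed

lemma Ck_compose_homothety:
  assumes "Ck n UNIV f"
  shows "Ck n UNIV (\<lambda>x. f (r *\<^sub>R (x - a)))"
  using assms
proof (induction n arbitrary: f)
  case 0
  then show ?case
    by (auto intro!: continuous_intros intro: continuous_on_compose2[of UNIV f])
next
  case (Suc n)
  have "((\<lambda>x. f (r *\<^sub>R (x - a))) has_derivative
      (\<lambda>b. frechet_derivative f (at (r *\<^sub>R (x - a))) (r *\<^sub>R b))) (at x)" for x
    by (rule has_derivative_compose[of "\<lambda>x. r *\<^sub>R (x - a)" "\<lambda>b. r *\<^sub>R b" x UNIV f])
      (auto intro!: derivative_eq_intros Ck_SucD(1)[OF Suc.prems])
  moreover have "frechet_derivative f (at s) (r *\<^sub>R b) = r *\<^sub>R frechet_derivative f (at s) b" for s b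
    by (rule linear_scale, rule linear_frechet_derivative) (use Suc.prems in simp)
  ultimately have "((\<lambda>x. f (r *\<^sub>R (x - a))) has_derivative
      (\<lambda>b. r *\<^sub>R frechet_derivative f (at (r *\<^sub>R (x - a))) b)) (at x)" for x
    by simp
  then show ?case
    by (rule Ck_SucI[OF open_UNIV])
      (assumption | intro Ck_bounded_linear[OF open_UNIV bounded_linear_scaleR_right] Suc.IH Ck_SucD(2)[OF Suc.prems])+
qed

lemma smooth_on_derivative:
  "smooth_on S f \<Longrightarrow> b \<in> Basis \<Longrightarrow> smooth_on S (\<lambda>x. frechet_derivative f (at x) b)"
  unfolding smooth_on_def using Ck_SucD(2) by blast

lemma smooth_on_has_derivative:
  "smooth_on S f \<Longrightarrow> x \<in> S \<Longrightarrow> (f has_derivative frechet_derivative f (at x)) (at x)"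
  unfolding smooth_on_def using Ck_SucD(1) by blast

lemma smooth_on_continuous_on: "smooth_on S f \<Longrightarrow> continuous_on S f"
  unfolding smooth_on_def using Ck_continuous_on by blast

lemma smooth_on_partial_deriv: "smooth_on S f \<Longrightarrow> smooth_on S (partial_deriv i f)"
  unfolding partial_deriv_def by (intro smooth_on_derivative) (auto simp: axis_in_Basis_iff)

section \<open>A smooth compactly supported potential\<close>

text \<open>The classical flat function \<open>exp (- 1 / t)\<close> with a polynomial in
  \<open>1 / t\<close> as a factor. The family is closed under differentiation, which makes
  smoothness an induction over all \<open>p\<close> at once.\<close>

definition flat :: "real poly \<Rightarrow> real \<Rightarrow> real" where
  "flat p t = (if 0 < t then poly p (inverse t) * exp (- inverse t) else 0)"

lemma poly_times_exp_minus_tendsto_0: "((\<lambda>s. poly p s * exp (- s)) \<longlongrightarrow> (0::real)) at_top"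
proof -
  have "((\<lambda>s. \<Sum>i\<le>degree p. coeff p i * (s ^ i / exp s)) \<longlongrightarrow> (\<Sum>i\<le>degree p. coeff p i * 0)) at_top"
    by (intro tendsto_sum tendsto_mult_left tendsto_power_div_exp_0)
  then show ?thesis
    by (simp add: poly_altdef exp_minus divide_inverse sum_distrib_right mult.assoc)
qed

lemma flat_tendsto_0: "(flat p \<longlongrightarrow> 0) (at 0)"
proof -
  have "((\<lambda>t. poly p (inverse t) * exp (- inverse t)) \<longlongrightarrow> 0) (at_right 0)"
    by (rule filterlim_compose[OF poly_times_exp_minus_tendsto_0 filterlim_inverse_at_top_right])
  then have "(flat p \<longlongrightarrow> 0) (at_right 0)"
    by (rule Lim_transform_eventually)
      (auto simp: flat_def eventually_at_filter)
  moreover have "(flat p \<longlongrightarrow> 0) (at_left 0)"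
    by (rule tendsto_eventually) (auto simp: flat_def eventually_at_filter)
  ultimately show ?thesis
    by (simp add: filterlim_at_split)
qed

text \<open>In the variable \<open>s = 1 / t\<close> one has \<open>d/dt = - s\<^sup>2 d/ds\<close>,
  and \<open>d/ds\<close> turns \<open>p exp (- s)\<close> into \<open>(p' - p) exp (- s)\<close>;
  \<open>[:0, 0, 1:]\<close> is the polynomial \<open>s\<^sup>2\<close>.\<close>

lemma DERIV_flat: "(flat p has_real_derivative flat ([:0, 0, 1:] * (p - pderiv p)) t) (at t)"
proof -
  let ?q = "[:0, 0, 1:] * (p - pderiv p)"
  consider "t < 0" | "0 < t" | "t = 0" by linarith
  then show ?thesis
  proof cases
    case 1
    have "((\<lambda>_. 0) has_real_derivative 0) (at t)" by simp
    then have "(flat p has_real_derivative 0) (at t)"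
      by (rule has_field_derivative_transform_within_open[of _ _ _ "{..<0}"])
        (use 1 in \<open>auto simp: flat_def\<close>)
    with 1 show ?thesis by (simp add: flat_def)
  next
    case 2
    have "((\<lambda>t. poly p (inverse t) * exp (- inverse t)) has_real_derivative
        poly ?q (inverse t) * exp (- inverse t)) (at t)"
      using 2 by (auto intro!: derivative_eq_intros simp: algebra_simps power2_eq_square)
    then have "(flat p has_real_derivative poly ?q (inverse t) * exp (- inverse t)) (at t)"
      by (rule has_field_derivative_transform_within_open[of _ _ _ "{0<..}"])
        (use 2 in \<open>auto simp: flat_def\<close>)
    with 2 show ?thesis by (simp add: flat_def)
  next
    case 3
    \<comment> \<open>Dividing by \<open>h\<close> multiplies the polynomial by its variable. At
      \<open>h = 0\<close> both sides are 0, because division by zero yields 0.\<close>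
    have "(\<lambda>h. (flat p (0 + h) - flat p 0) / h) = flat ([:0, 1:] * p)"
      by (auto simp: flat_def divide_inverse)
    then have "(flat p has_real_derivative 0) (at 0)"
      unfolding DERIV_def using flat_tendsto_0[of "[:0, 1:] * p"] by simp
    with 3 show ?thesis by (simp add: flat_def)
  qed
qed

lemma Ck_flat: "Ck n UNIV (flat p)"
proof (induction n arbitrary: p)
  case 0
  have "isCont (flat p) t" for t
    using DERIV_flat by (rule DERIV_isCont)
  then show ?case by (simp add: continuous_at_imp_continuous_on)
next
  case (Suc n)
  show ?case
  proof (rule Ck_SucI[OF open_UNIV])
    show "(flat p has_derivative (\<lambda>b. flat ([:0, 0, 1:] * (p - pderiv p)) t * b)) (at t)" for t
      using DERIV_flat[of p t] by (simp add: has_field_derivative_def)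
    show "b \<in> Basis \<Longrightarrow> Ck n UNIV (\<lambda>t. flat ([:0, 0, 1:] * (p - pderiv p)) t * b)" for b
      using Suc.IH[of "[:0, 0, 1:] * (p - pderiv p)"] by (simp add: Basis_real_def)
  qed
qed

text \<open>The product of \<open>exp (- 1 / (1 + t))\<close> and
  \<open>exp (- 1 / (1 - t))\<close>: each factor cuts off one side, which leaves the support
  between -1 and 1.\<close>

definition bump1 :: "real \<Rightarrow> real" where
  "bump1 t = flat 1 (t + 1) * flat 1 (- t + 1)"

lemma smooth_bump1: "smooth_on UNIV bump1"
  unfolding smooth_on_def bump1_def
  by (intro allI Ck_mult open_UNIV Ck_compose_functional[of "\<lambda>t. t"]
      Ck_compose_functional[of uminus] Ck_flat bounded_linear_ident
      bounded_linear_minus[OF bounded_linear_ident])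

lemma bump1_eq_0: "1 \<le> \<bar>t\<bar> \<Longrightarrow> bump1 t = 0"
  by (auto simp: bump1_def flat_def)

lemma bump1_pos: "0 < bump1 0"
  by (simp add: bump1_def flat_def)

definition tensor3 ::
    "(real \<Rightarrow> real) \<Rightarrow> (real \<Rightarrow> real) \<Rightarrow> (real \<Rightarrow> real) \<Rightarrow> real^3 \<Rightarrow> real" where
  "tensor3 u v w x = u (x $ 1) * v (x $ 2) * w (x $ 3)"

abbreviation diff1 :: "(real \<Rightarrow> real) \<Rightarrow> real \<Rightarrow> real" where
  "diff1 u t \<equiv> frechet_derivative u (at t) 1"

lemma smooth_diff1: "smooth_on UNIV u \<Longrightarrow> smooth_on UNIV (diff1 u)"
  by (rule smooth_on_derivative) (simp_all add: Basis_real_def)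

lemma has_real_derivative_diff1:
  assumes "smooth_on UNIV u"
  shows "(u has_real_derivative diff1 u t) (at t)"
proof -
  have D: "(u has_derivative frechet_derivative u (at t)) (at t)"
    using smooth_on_has_derivative[OF assms] by simp
  have "frechet_derivative u (at t) h = diff1 u t * h" for h
    using linear_scale[OF has_derivative_linear[OF D], of h 1] by simp
  then have "frechet_derivative u (at t) = (*) (diff1 u t)"
    by (rule ext)
  then show ?thesis
    using D by (simp only: has_field_derivative_def)
qed

lemma smooth_tensor3:
  assumes "smooth_on UNIV u" "smooth_on UNIV v" "smooth_on UNIV w"
  shows "smooth_on UNIV (tensor3 u v w)"
proof -
  have nth: "Ck n UNIV (\<lambda>x::real^3. f (x $ i))" if "smooth_on UNIV f" for n i and f :: "real \<Rightarrow> real"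
    using Ck_compose_functional[OF bounded_linear_vec_nth, of n f i 0] that
    by (simp add: smooth_on_def)
  show ?thesis
    unfolding smooth_on_def tensor3_def by (intro allI Ck_mult open_UNIV nth assms)
qed

lemma partial_deriv_eqI:
  "(f has_derivative D) (at x) \<Longrightarrow> partial_deriv i f x = D (axis i 1)"
  unfolding partial_deriv_def using frechet_derivative_at by metis

lemma partial_deriv_tensor3:
  assumes "smooth_on UNIV u" "smooth_on UNIV v" "smooth_on UNIV w"
  shows "partial_deriv 1 (tensor3 u v w) = tensor3 (diff1 u) v w"
    and "partial_deriv 2 (tensor3 u v w) = tensor3 u (diff1 v) w"
    and "partial_deriv 3 (tensor3 u v w) = tensor3 u v (diff1 w)"
proof -
  have D: "((\<lambda>x::real^3. f (x $ i)) has_derivative (\<lambda>h. diff1 f (x $ i) * h $ i)) (at x)"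
    if "smooth_on UNIV f" for f :: "real \<Rightarrow> real" and i x
  proof -
    show ?thesis
      by (rule has_derivative_compose[of "\<lambda>x. x $ i" "\<lambda>h. h $ i" x UNIV f])
        (auto intro!: bounded_linear_imp_has_derivative bounded_linear_vec_nth
          has_real_derivative_diff1[OF that, unfolded has_field_derivative_def])
  qed
  have "partial_deriv i (tensor3 u v w) x =
      u (x $ 1) * v (x $ 2) * (diff1 w (x $ 3) * axis i 1 $ 3) +
      (u (x $ 1) * (diff1 v (x $ 2) * axis i 1 $ 2) + diff1 u (x $ 1) * axis i 1 $ 1 * v (x $ 2)) * w (x $ 3)" for i x
    unfolding tensor3_def
    by (rule partial_deriv_eqI) (intro has_derivative_mult D assms)
  then show "partial_deriv 1 (tensor3 u v w) = tensor3 (diff1 u) v w"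
    and "partial_deriv 2 (tensor3 u v w) = tensor3 u (diff1 v) w"
    and "partial_deriv 3 (tensor3 u v w) = tensor3 u v (diff1 w)"
    by (auto simp: fun_eq_iff tensor3_def axis_def)
qed

text \<open>The mixed partial derivatives are compared explicitly, using the product structure, instead of
  appealing to Schwarz's theorem.\<close>

lemma smooth_potential:
  "\<exists>\<psi> :: real^3 \<Rightarrow> real. smooth_on UNIV \<psi> \<and> (\<forall>x. 2 < norm x \<longrightarrow> \<psi> x = 0) \<and>
    (\<forall>i j. partial_deriv i (partial_deriv j \<psi>) = partial_deriv j (partial_deriv i \<psi>)) \<and>
    (\<exists>x. partial_deriv 1 \<psi> x \<noteq> 0)"
proof (intro exI[of _ "tensor3 bump1 bump1 bump1"] conjI allI impI)
  note smooth = smooth_bump1 smooth_diff1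
  show "smooth_on UNIV (tensor3 bump1 bump1 bump1)"
    by (intro smooth_tensor3 smooth)
  show "tensor3 bump1 bump1 bump1 x = 0" if "2 < norm x" for x
  proof (rule ccontr)
    assume "tensor3 bump1 bump1 bump1 x \<noteq> 0"
    \<comment> \<open>The support lies in a cube whose points have squared norm at most 3, which is
      below the square of the radius 2.\<close>
    then have "\<bar>x $ 1\<bar> < 1" "\<bar>x $ 2\<bar> < 1" "\<bar>x $ 3\<bar> < 1"
      using bump1_eq_0 not_le by (auto simp: tensor3_def)
    then have "(x $ 1)\<^sup>2 < 1" "(x $ 2)\<^sup>2 < 1" "(x $ 3)\<^sup>2 < 1"
      by (simp_all add: abs_square_less_1)
    then have "x \<bullet> x \<le> 3"
      by (simp add: inner_vec_def sum_3 power2_eq_square)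
    moreover have "2\<^sup>2 < (norm x)\<^sup>2"
      using that by (intro power_strict_mono) auto
    ultimately show False
      by (simp add: power2_norm_eq_inner)
  qed
  show "partial_deriv i (partial_deriv j (tensor3 bump1 bump1 bump1)) =
      partial_deriv j (partial_deriv i (tensor3 bump1 bump1 bump1))" for i j
    using exhaust_3[of i] exhaust_3[of j]
    by (elim disjE) (simp_all add: partial_deriv_tensor3 smooth)
  have "\<exists>t. diff1 bump1 t \<noteq> 0"
  proof (rule ccontr)
    assume "\<nexists>t. diff1 bump1 t \<noteq> 0"
    then have "diff1 bump1 t = 0" for t by blast
    moreover have "(bump1 has_real_derivative diff1 bump1 t) (at t)" for t
      by (rule has_real_derivative_diff1[OF smooth_bump1])
    ultimately have "bump1 0 = bump1 1"
      by (intro DERIV_isconst_all) simp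
    then show False
      using bump1_pos bump1_eq_0[of 1] by simp
  qed
  then obtain t where "diff1 bump1 t \<noteq> 0" ..
  \<comment> \<open>At the point \<open>(t, 0, 0)\<close> the other two factors are
    \<open>bump1 0\<close>, which is positive.\<close>
  then have "partial_deriv 1 (tensor3 bump1 bump1 bump1) (axis 1 t) \<noteq> 0"
    using bump1_pos by (simp add: partial_deriv_tensor3 smooth tensor3_def axis_def)
  then show "\<exists>x. partial_deriv 1 (tensor3 bump1 bump1 bump1) x \<noteq> 0" ..
qed

section \<open>Integration of derivatives\<close>

lemma integrable_continuous_bounded_support:
  fixes g :: "'a::euclidean_space \<Rightarrow> 'b::{banach,second_countable_topology}"
  assumes "continuous_on UNIV g" "\<And>x. R < norm x \<Longrightarrow> g x = 0"
  shows "integrable lborel g"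
proof -
  have "integrable lborel (\<lambda>x. indicator (cball 0 R) x *\<^sub>R g x)"
    using assms(1) by (intro borel_integrable_compact) (auto intro: continuous_on_subset)
  moreover have "(\<lambda>x. indicator (cball 0 R) x *\<^sub>R g x) = g"
    using assms(2) by (auto simp: fun_eq_iff indicator_def)
  ultimately show ?thesis by simp
qed

lemma derivative_eq_0_if_locally_0:
  assumes "open S" "x \<in> S" "\<And>y. y \<in> S \<Longrightarrow> f y = 0" "(f has_derivative D) (at x)"
  shows "D b = 0"
proof -
  have "((\<lambda>_. 0) has_derivative D) (at x)"
    by (rule has_derivative_transform_within_open[OF assms(4,1,2)]) (use assms(3) in auto)
  then have "D = (\<lambda>_. 0)"
    using has_derivative_const has_derivative_unique by blast
  then show ?thesis by simp
qed

lemma open_norm_greater: "open {x::'a::real_normed_vector. R < norm x}"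
  by (intro open_Collect_less continuous_intros)

lemma lborel_integral_translate:
  fixes h :: "'a::euclidean_space \<Rightarrow> real"
  assumes [measurable]: "h \<in> borel_measurable borel"
  shows "(LINT x|lborel. h (x + c)) = (LINT x|lborel. h x)"
proof -
  have "(LINT x|lborel. h x) = (LINT x|distr lborel borel ((+) c). h x)"
    by (simp add: lborel_distr_plus)
  also have "\<dots> = (LINT x|lborel. h (c + x))"
    by (rule integral_distr) auto
  finally show ?thesis by (simp add: add.commute)
qed

text \<open>By translation invariance all difference quotients have integral zero, and they converge
  dominatedly.\<close>

lemma integral_directional_derivative_eq_0:
  fixes h :: "'a::euclidean_space \<Rightarrow> real"
  assumes D: "\<And>x. (h has_derivative D x) (at x)"
    and cont: "continuous_on UNIV (\<lambda>x. D x e)"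
    and supp: "\<And>x. R < norm x \<Longrightarrow> h x = 0"
  shows "(LINT x|lborel. D x e) = 0"
proof -
  have h_cont: "continuous_on UNIV h"
    using D by (auto intro!: continuous_at_imp_continuous_on has_derivative_continuous)
  have [measurable]: "h \<in> borel_measurable borel" "(\<lambda>x. D x e) \<in> borel_measurable borel"
    using h_cont cont by (auto intro: borel_measurable_continuous_onI)
  have h_int: "integrable lborel h"
    using h_cont supp by (rule integrable_continuous_bounded_support)
  have D0: "D x e = 0" if "R < norm x" for x
    by (rule derivative_eq_0_if_locally_0[OF open_norm_greater _ _ D, of _ R]) (use that supp in auto)
  have "compact ((\<lambda>x. D x e) ` cball 0 R)"
    by (intro compact_continuous_image continuous_on_subset[OF cont]) auto
  then have "bounded ((\<lambda>x. D x e) ` cball 0 R)"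
    by (rule compact_imp_bounded)
  then obtain M0 where "\<forall>y\<in>(\<lambda>x. D x e) ` cball 0 R. norm y \<le> M0"
    unfolding bounded_iff by blast
  then have M0: "\<bar>D x e\<bar> \<le> M0" if "norm x \<le> R" for x
    using that by simp
  define M where "M = max M0 0"
  have M: "\<bar>D x e\<bar> \<le> M" for x
    using M0[of x] D0[of x] unfolding M_def by (cases "norm x \<le> R") auto
  define t where "t n = inverse (real (Suc n))" for n
  have t: "0 < t n" "t n \<le> 1" for n
    by (auto simp: t_def field_simps)
  define q where "q n x = (h (x + t n *\<^sub>R e) - h x) / t n" for n x
  have line: "((\<lambda>s. h (x + s *\<^sub>R e)) has_real_derivative D (x + s *\<^sub>R e) e) (at s)" for x s
  proof -
    have "((\<lambda>s. h (x + s *\<^sub>R e)) has_derivative (\<lambda>d. D (x + s *\<^sub>R e) (d *\<^sub>R e))) (at s)"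
      by (rule has_derivative_compose[of "\<lambda>s. x + s *\<^sub>R e" "\<lambda>d. d *\<^sub>R e" s UNIV h])
        (auto intro!: derivative_eq_intros D)
    moreover have "D (x + s *\<^sub>R e) (d *\<^sub>R e) = D (x + s *\<^sub>R e) e * d" for d
      using linear_scale[OF has_derivative_linear[OF D]] by simp
    ultimately show ?thesis by (simp add: has_field_derivative_def)
  qed
  have q_le: "\<bar>q n x\<bar> \<le> M" for n x
  proof -
    \<comment> \<open>By the mean value theorem every difference quotient is a value of the
      derivative, so \<open>M\<close> bounds them uniformly in \<open>n\<close> and
      \<open>x\<close>.\<close>
    obtain z where "h (x + t n *\<^sub>R e) - h (x + 0 *\<^sub>R e) = (t n - 0) * D (x + z *\<^sub>R e) e"
      using MVT2[OF t(1)[of n] line[of x]] by blast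
    then have "q n x = D (x + z *\<^sub>R e) e"
      using t(1)[of n] by (simp add: q_def)
    then show ?thesis using M by simp
  qed
  \<comment> \<open>Since \<open>t n \<le> 1\<close>, a translation moves points by at most
    \<open>norm e\<close>, so all quotients vanish outside one fixed ball and \<open>M\<close> on
    that ball is an integrable majorant. The absolute value covers a negative
    \<open>R\<close>.\<close>
  have far: "R < norm (x + t n *\<^sub>R e)" "R < norm x" if "\<bar>R\<bar> + norm e < norm x" for n x
  proof -
    have "norm x \<le> norm (x + t n *\<^sub>R e) + norm (t n *\<^sub>R e)"
      using norm_triangle_ineq4[of "x + t n *\<^sub>R e" "t n *\<^sub>R e"] by simp
    moreover have "norm (t n *\<^sub>R e) \<le> norm e"
      using t[of n] by (simp add: mult_left_le_one_le)
    ultimately show "R < norm (x + t n *\<^sub>R e)" "R < norm x"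
      using that norm_ge_zero[of e] by linarith+
  qed
  then have q_supp: "q n x = 0" if "\<bar>R\<bar> + norm e < norm x" for n x
    using that by (simp add: q_def supp)
  have "(\<lambda>n. LINT x|lborel. q n x) \<longlonglongrightarrow> (LINT x|lborel. D x e)"
  proof (rule integral_dominated_convergence)
    show "integrable lborel (\<lambda>x. indicator (cball (0::'a) (\<bar>R\<bar> + norm e)) x *\<^sub>R M)"
      by (intro borel_integrable_compact continuous_intros) auto
    show "AE x in lborel. (\<lambda>n. q n x) \<longlonglongrightarrow> D x e"
    proof (rule AE_I2)
      fix x
      have "((\<lambda>s. (h (x + s *\<^sub>R e) - h x) / s) \<longlongrightarrow> D x e) (at 0)"
        using line[of x 0] by (simp add: DERIV_def)
      moreover have "filterlim t (at 0) sequentially"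
        unfolding filterlim_at
        using t LIMSEQ_inverse_real_of_nat by (auto simp: t_def[abs_def])
      ultimately show "(\<lambda>n. q n x) \<longlonglongrightarrow> D x e"
        unfolding q_def by (rule filterlim_compose)
    qed
    show "AE x in lborel. norm (q n x) \<le> indicator (cball 0 (\<bar>R\<bar> + norm e)) x *\<^sub>R M" for n
      using q_le q_supp by (auto simp: indicator_def)
    show "q n \<in> borel_measurable lborel" for n
      unfolding q_def by measurable
  qed simp
  moreover have "(LINT x|lborel. q n x) = 0" for n
  proof -
    have "integrable lborel (\<lambda>x. h (x + t n *\<^sub>R e))"
    proof (rule integrable_continuous_bounded_support[of _ "\<bar>R\<bar> + norm e"])
      show "continuous_on UNIV (\<lambda>x. h (x + t n *\<^sub>R e))"
        by (intro continuous_on_compose2[OF h_cont] continuous_intros) auto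
      show "h (x + t n *\<^sub>R e) = 0" if "\<bar>R\<bar> + norm e < norm x" for x
        using far(1)[OF that] by (rule supp)
    qed
    then show ?thesis
      using h_int by (simp add: q_def lborel_integral_translate)
  qed
  ultimately show ?thesis
    by (simp add: LIMSEQ_const_iff)
qed

section \<open>Divergence, rotation and scaling under the integral\<close>

lemma partial_deriv_nth:
  assumes "f differentiable (at x)"
  shows "((\<lambda>x. f x $ j) has_derivative (\<lambda>b. frechet_derivative f (at x) b $ j)) (at x)"
  using assms
  by (intro bounded_linear.has_derivative[OF bounded_linear_vec_nth]) (simp add: frechet_derivative_works)

lemma partial_deriv_continuous:
  "Ck (Suc 0) S f \<Longrightarrow> continuous_on S (partial_deriv i f)"
  unfolding partial_deriv_def[abs_def] by (auto simp: axis_in_Basis_iff)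

lemma partial_deriv_eq_0:
  assumes "open S" "x \<in> S" "\<And>y. y \<in> S \<Longrightarrow> f y = 0"
  shows "partial_deriv i f x = 0"
proof -
  have "((\<lambda>_. 0) has_derivative (\<lambda>_. 0)) (at x)" by simp
  then have "(f has_derivative (\<lambda>_. 0)) (at x)"
    by (rule has_derivative_transform_within_open[OF _ assms(1,2)]) (use assms(3) in auto)
  then show ?thesis by (rule partial_deriv_eqI)
qed

lemma integral_divergence_eq_0:
  assumes f: "Ck (Suc 0) UNIV f" and supp: "\<And>x. R < norm x \<Longrightarrow> f x = 0"
  shows "(LINT x|lborel. divergence f x) = 0"
proof -
  have supp': "partial_deriv i f x = 0" if "R < norm x" for i x
    by (rule partial_deriv_eq_0[OF open_norm_greater, of _ R]) (use that supp in auto)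
  have int: "integrable lborel (\<lambda>x. partial_deriv i f x $ i)" for i
    by (rule integrable_continuous_bounded_support[of _ R])
      (auto intro!: continuous_intros partial_deriv_continuous f simp: supp')
  have "(LINT x|lborel. frechet_derivative f (at x) (axis i 1) $ i) = 0" for i
  proof (rule integral_directional_derivative_eq_0)
    show "((\<lambda>x. f x $ i) has_derivative (\<lambda>b. frechet_derivative f (at x) b $ i)) (at x)" for x
      using f by (intro partial_deriv_nth) auto
    show "continuous_on UNIV (\<lambda>x. frechet_derivative f (at x) (axis i 1) $ i)"
      using partial_deriv_continuous[OF f, of i] unfolding partial_deriv_def
      by (intro continuous_intros)
    show "R < norm x \<Longrightarrow> f x $ i = 0" for x
      by (simp add: supp)
  qed
  then show ?thesis
    using int by (simp add: divergence_def partial_deriv_def)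
qed

lemma partial_deriv_cross3:
  assumes "Ck (Suc 0) UNIV f" "Ck (Suc 0) UNIV g"
  shows "partial_deriv i (\<lambda>x. cross3 (f x) (g x)) x =
      cross3 (f x) (partial_deriv i g x) + cross3 (partial_deriv i f x) (g x)"
proof -
  have "bounded_bilinear cross3"
    using bilinear_cross by (simp only: bilinear_conv_bounded_bilinear)
  from bounded_bilinear.FDERIV[OF this Ck_SucD(1)[OF assms(1) UNIV_I] Ck_SucD(1)[OF assms(2) UNIV_I]]
  show ?thesis
    unfolding partial_deriv_def[of _ g] partial_deriv_def[of _ f]
    by (rule partial_deriv_eqI)
qed

lemma Ck1_cross3:
  assumes f: "Ck (Suc 0) UNIV f" and g: "Ck (Suc 0) UNIV g"
  shows "Ck (Suc 0) UNIV (\<lambda>x. cross3 (f x) (g x))"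
proof -
  have bb: "bounded_bilinear cross3"
    using bilinear_cross by (simp only: bilinear_conv_bounded_bilinear)
  show ?thesis
  proof (rule Ck_SucI[OF open_UNIV])
    show "((\<lambda>x. cross3 (f x) (g x)) has_derivative (\<lambda>b. cross3 (f x) (frechet_derivative g (at x) b) +
        cross3 (frechet_derivative f (at x) b) (g x))) (at x)" for x
      by (rule bounded_bilinear.FDERIV[OF bb Ck_SucD(1)[OF f UNIV_I] Ck_SucD(1)[OF g UNIV_I]])
    show "Ck 0 UNIV (\<lambda>x. cross3 (f x) (frechet_derivative g (at x) b) +
        cross3 (frechet_derivative f (at x) b) (g x))" if "b \<in> Basis" for b
      using Ck_continuous_on[OF f] Ck_continuous_on[OF g] Ck_SucD(2)[OF f that] Ck_SucD(2)[OF g that]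
      by (auto intro!: continuous_on_add bounded_bilinear.continuous_on[OF bb])
  qed
qed

text \<open>Integrated with one factor compactly supported, this identity makes the rotation
  formally symmetric; it is the integration by parts behind
  \<open>weak_rot_eigenfield\<close>.\<close>

lemma divergence_cross3:
  assumes "Ck (Suc 0) UNIV f" "Ck (Suc 0) UNIV g"
  shows "divergence (\<lambda>x. cross3 (f x) (g x)) x = g x \<bullet> rot f x - f x \<bullet> rot g x"
  unfolding divergence_def partial_deriv_cross3[OF assms] rot_def
  by (simp add: cross3_def sum_3 inner_vec_def vector_3 algebra_simps)

lemma lborel_integral_homothety:
  fixes f :: "'a::euclidean_space \<Rightarrow> real"
  assumes [measurable]: "f \<in> borel_measurable borel" and s: "0 < s"
  shows "(LINT x|lborel. f ((1 / s) *\<^sub>R (x - a))) = s ^ DIM('a) * (LINT x|lborel. f x)"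
proof -
  let ?F = "\<lambda>x. f ((1 / s) *\<^sub>R (x - a))"
  have "(LINT x|lborel. ?F x) =
      (LINT x|density (distr lborel borel (\<lambda>x. a + s *\<^sub>R x)) (\<lambda>_. ennreal (\<bar>s\<bar> ^ DIM('a))). ?F x)"
    using lborel_affine[of s a] s by simp
  also have "\<dots> = (LINT x|distr lborel borel (\<lambda>x. a + s *\<^sub>R x). \<bar>s\<bar> ^ DIM('a) *\<^sub>R ?F x)"
    by (rule integral_density) auto
  also have "\<dots> = (LINT x|lborel. \<bar>s\<bar> ^ DIM('a) *\<^sub>R ?F (a + s *\<^sub>R x))"
    by (rule integral_distr) auto
  finally show ?thesis
    using s by simp
qed

lemma partial_deriv_homothety:
  assumes "f differentiable (at (r *\<^sub>R (x - a)))"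
  shows "partial_deriv i (\<lambda>x. f (r *\<^sub>R (x - a))) x = r *\<^sub>R partial_deriv i f (r *\<^sub>R (x - a))"
proof -
  have "partial_deriv i (\<lambda>x. f (r *\<^sub>R (x - a))) x =
      frechet_derivative f (at (r *\<^sub>R (x - a))) (r *\<^sub>R axis i 1)"
    by (rule partial_deriv_eqI, rule has_derivative_compose[of "\<lambda>x. r *\<^sub>R (x - a)" "\<lambda>b. r *\<^sub>R b" x UNIV f])
      (use assms in \<open>auto intro!: derivative_eq_intros simp: frechet_derivative_works\<close>)
  also have "\<dots> = r *\<^sub>R partial_deriv i f (r *\<^sub>R (x - a))"
    unfolding partial_deriv_def
    by (rule linear_scale, rule linear_frechet_derivative) (rule assms)
  finally show ?thesis .
qed

text \<open>A vanishing integral would make the set where \<open>f\<close> is nonzero a null set,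
  but that set is open and nonempty.\<close>

lemma integral_pos_if_continuous:
  fixes f :: "'a::euclidean_space \<Rightarrow> real"
  assumes cont: "continuous_on UNIV f" and int: "integrable lborel f"
    and nonneg: "\<And>x. 0 \<le> f x" and "f x \<noteq> 0"
  shows "0 < (LINT x|lborel. f x)"
proof -
  have "(LINT x|lborel. f x) \<noteq> 0"
  proof
    assume "(LINT x|lborel. f x) = 0"
    then have "AE x in lborel. f x = 0"
      using integral_nonneg_eq_0_iff_AE[OF int] nonneg by simp
    moreover have op: "open {x. f x \<noteq> 0}"
      by (intro open_Collect_neq cont continuous_intros)
    ultimately have "{x. f x \<noteq> 0} \<in> null_sets lborel"
      by (subst (asm) AE_iff_null) auto
    then have "negligible {x. f x \<noteq> 0}"
      by (simp add: negligible_iff_null_sets null_sets_completionI)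
    then show False
      using open_not_negligible[OF op] \<open>f x \<noteq> 0\<close> by blast
  qed
  moreover have "0 \<le> (LINT x|lborel. f x)"
    using nonneg by (simp add: integral_nonneg_AE)
  ultimately show ?thesis by linarith
qed

section \<open>Weak rotation and the spectrum\<close>

lemma l2class_cong: "(\<And>x. x \<in> \<Omega> \<Longrightarrow> f x = g x) \<Longrightarrow> l2class \<Omega> f = l2class \<Omega> g"
proof -
  assume eq: "\<And>x. x \<in> \<Omega> \<Longrightarrow> f x = g x"
  have "(\<lambda>x. indicator \<Omega> x *\<^sub>R f x) = (\<lambda>x. indicator \<Omega> x *\<^sub>R g x)"
  proof
    show "indicator \<Omega> x *\<^sub>R f x = indicator \<Omega> x *\<^sub>R g x" for x
      by (cases "x \<in> \<Omega>") (simp_all add: eq)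
  qed
  then show ?thesis
    by (simp add: l2class_def)
qed

lemma sq_integrable_restrict:
  assumes "open \<Omega>" "bounded \<Omega>" "continuous_on UNIV g"
  shows "sq_integrable (\<lambda>x. indicator \<Omega> x *\<^sub>R g x)"
  unfolding sq_integrable_def
proof
  have [measurable]: "g \<in> borel_measurable borel" "\<Omega> \<in> sets borel"
    using assms by (auto intro: borel_measurable_continuous_onI)
  show "(\<lambda>x. indicator \<Omega> x *\<^sub>R g x) \<in> borel_measurable lborel"
    by measurable
  have "integrable lborel (\<lambda>x. indicator (closure \<Omega>) x *\<^sub>R (norm (g x))\<^sup>2)"
    using assms(2)
    by (intro borel_integrable_compact) (auto intro!: continuous_intros continuous_on_subset[OF assms(3)])
  then have "integrable lborel (\<lambda>x. indicator \<Omega> x *\<^sub>R indicator (closure \<Omega>) x *\<^sub>R (norm (g x))\<^sup>2)"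
    by (rule integrable_mult_indicator[rotated]) simp
  moreover have "(\<lambda>x. indicator \<Omega> x *\<^sub>R indicator (closure \<Omega>) x *\<^sub>R (norm (g x))\<^sup>2)
      = (\<lambda>x. (norm (indicator \<Omega> x *\<^sub>R g x))\<^sup>2)"
    using closure_subset[of \<Omega>] by (auto simp: indicator_def fun_eq_iff)
  ultimately show "integrable lborel (\<lambda>x. (norm (indicator \<Omega> x *\<^sub>R g x))\<^sup>2)"
    by simp
qed

lemma inner_l2class:
  assumes "sq_integrable (\<lambda>x. indicator \<Omega> x *\<^sub>R f x)" "sq_integrable (\<lambda>x. indicator \<Omega> x *\<^sub>R g x)"
  shows "l2class \<Omega> f \<bullet> l2class \<Omega> g = (LINT x|lborel. indicator \<Omega> x * (f x \<bullet> g x))"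
proof -
  have "l2class \<Omega> f \<bullet> l2class \<Omega> g =
      (LINT x|lborel. (indicator \<Omega> x *\<^sub>R f x) \<bullet> (indicator \<Omega> x *\<^sub>R g x))"
    using assms by transfer simp
  also have "\<dots> = (LINT x|lborel. indicator \<Omega> x * (f x \<bullet> g x))"
    by (intro Bochner_Integration.integral_cong) (auto simp: indicator_def)
  finally show ?thesis .
qed

lemma l2class_scaleR:
  assumes "sq_integrable (\<lambda>x. indicator \<Omega> x *\<^sub>R f x)"
  shows "l2class \<Omega> (\<lambda>x. c *\<^sub>R f x) = c *\<^sub>R l2class \<Omega> f"
proof -
  have eq: "(\<lambda>x. indicator \<Omega> x *\<^sub>R c *\<^sub>R f x) = (\<lambda>x. c *\<^sub>R indicator \<Omega> x *\<^sub>R f x)"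
    by (simp add: mult.commute)
  have "sq_integrable (\<lambda>x. indicator \<Omega> x *\<^sub>R c *\<^sub>R f x)"
    unfolding eq using assms by (rule sq_integrable_scaleR)
  with assms show ?thesis
    by transfer (auto simp: mult.commute)
qed

lemma l2class_eq_0: "(\<And>x. x \<in> \<Omega> \<Longrightarrow> f x = 0) \<Longrightarrow> l2class \<Omega> f = 0"
proof -
  assume "\<And>x. x \<in> \<Omega> \<Longrightarrow> f x = 0"
  then have "l2class \<Omega> f = l2class \<Omega> (\<lambda>_. 0)"
    by (rule l2class_cong)
  also have "\<dots> = 0"
    by transfer (simp add: sq_integrable_zero)
  finally show ?thesis .
qed

lemma test_fieldsI:
  assumes "smooth_on UNIV \<phi>" "compact K" "K \<subseteq> \<Omega>" "\<And>x. x \<notin> K \<Longrightarrow> \<phi> x = 0"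
  shows "\<phi> \<in> test_fields \<Omega>"
proof -
  have "closure {x. \<phi> x \<noteq> 0} \<subseteq> K"
    using assms(2,4) by (intro closure_minimal compact_imp_closed) auto
  moreover from this have "compact (closure {x. \<phi> x \<noteq> 0})"
    using assms(2) by (metis closed_closure compact_Int_closed inf.absorb_iff2)
  ultimately show ?thesis
    using assms(1,3) by (auto simp: test_fields_def)
qed

lemma smooth_on_Ck1: "smooth_on S f \<Longrightarrow> Ck (Suc 0) S f"
  by (simp only: smooth_on_def)

lemma vector_3_axis:
  "(vector [a, b, c] :: real^3) = a *\<^sub>R axis 1 1 + b *\<^sub>R axis 2 1 + c *\<^sub>R axis 3 1"
  by (simp add: vec_eq_iff forall_3 axis_def)

lemma rot_continuous:
  assumes "Ck (Suc 0) UNIV f"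
  shows "continuous_on UNIV (rot f)"
  unfolding rot_def[abs_def] vector_3_axis
  by (intro continuous_intros partial_deriv_continuous assms)

lemma rot_cong:
  assumes "open S" "x \<in> S" "\<And>y. y \<in> S \<Longrightarrow> f y = g y" "g differentiable (at x)"
  shows "rot f x = rot g x"
proof -
  have "frechet_derivative g (at x) = frechet_derivative f (at x)"
    by (rule frechet_derivative_transform_within_open[OF assms(4,1,2)]) (use assms(3) in auto)
  then show ?thesis by (simp add: rot_def partial_deriv_def)
qed

text \<open>The field is replaced by a smooth extension \<open>g\<close> to the whole space, so that
  its cross product with a test field is continuously differentiable everywhere. The test field
  vanishes near the boundary, hence the integration by parts has no boundary term.\<close>

lemma weak_rot_eigenfield:
  assumes \<Omega>: "open \<Omega>" "bounded \<Omega>" and u: "smooth_upto_boundary \<Omega> u"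
    and eigen: "\<And>x. x \<in> \<Omega> \<Longrightarrow> rot u x = c *\<^sub>R u x"
  shows "weak_rot \<Omega> (l2class \<Omega> u) (c *\<^sub>R l2class \<Omega> u)"
  unfolding weak_rot_def
proof
  fix \<phi> assume \<phi>: "\<phi> \<in> test_fields \<Omega>"
  obtain g where g: "smooth_on UNIV g" and ug: "\<And>x. x \<in> closure \<Omega> \<Longrightarrow> u x = g x"
    using u by (auto simp: smooth_upto_boundary_def)
  have ug': "u x = g x" if "x \<in> \<Omega>" for x
    using ug that closure_subset by blast
  have class_u: "l2class \<Omega> u = l2class \<Omega> g"
    by (rule l2class_cong) (rule ug')
  have g1: "Ck (Suc 0) UNIV g"
    using g by (rule smooth_on_Ck1)
  have "rot g x = c *\<^sub>R g x" if "x \<in> \<Omega>" for x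
  proof -
    have "rot u x = rot g x"
      by (rule rot_cong[OF \<Omega>(1) that ug'])
        (use smooth_on_has_derivative[OF g] in \<open>auto intro: differentiableI\<close>)
    then show ?thesis
      using eigen[OF that] ug'[OF that] by simp
  qed
  then have rot_g: "l2class \<Omega> (rot g) = c *\<^sub>R l2class \<Omega> g"
    using l2class_cong[of \<Omega> "rot g" "\<lambda>x. c *\<^sub>R g x"] l2class_scaleR
      sq_integrable_restrict[OF \<Omega> smooth_on_continuous_on[OF g]] by simp
  have \<phi>1: "Ck (Suc 0) UNIV \<phi>"
    using \<phi> by (simp only: test_fields_def smooth_on_Ck1 mem_Collect_eq)
  \<comment> \<open>\<open>K\<close> is the closed support of \<open>\<phi>\<close>. Its complement
    is open, so the derivatives of \<open>\<phi>\<close> vanish there too, and the integrals over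
    the domain and over the whole space agree.\<close>
  obtain K where K: "compact K" "K \<subseteq> \<Omega>" and \<phi>0: "\<And>x. x \<notin> K \<Longrightarrow> \<phi> x = 0"
  proof (rule that[of "closure {x. \<phi> x \<noteq> 0}"])
    show "compact (closure {x. \<phi> x \<noteq> 0})" "closure {x. \<phi> x \<noteq> 0} \<subseteq> \<Omega>"
      using \<phi> by (simp_all only: test_fields_def mem_Collect_eq)
    show "\<phi> x = 0" if "x \<notin> closure {x. \<phi> x \<noteq> 0}" for x
      using that closure_subset[of "{x. \<phi> x \<noteq> 0}"] by blast
  qed
  have rot_\<phi>0: "rot \<phi> x = 0" if "x \<notin> K" for x
  proof -
    have "partial_deriv i \<phi> x = 0" for i
      by (rule partial_deriv_eq_0[of "- K"]) (use that \<phi>0 K(1) in \<open>auto intro: compact_imp_closed\<close>)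
    then show ?thesis by (simp add: rot_def vec_eq_iff forall_3)
  qed
  obtain R where "\<forall>x\<in>K. norm x \<le> R"
    using compact_imp_bounded[OF K(1)] unfolding bounded_iff by blast
  then have R: "x \<notin> K" if "R < norm x" for x
    using that by force
  note sq = sq_integrable_restrict[OF \<Omega>]
  note cont = smooth_on_continuous_on[OF g] Ck_continuous_on[OF \<phi>1] rot_continuous[OF g1] rot_continuous[OF \<phi>1]
  have "(LINT x|lborel. g x \<bullet> rot \<phi> x - \<phi> x \<bullet> rot g x) = 0"
    using integral_divergence_eq_0[OF Ck1_cross3[OF \<phi>1 g1], of R] R \<phi>0
    by (simp add: divergence_cross3[OF \<phi>1 g1])
  moreover have "integrable lborel (\<lambda>x. g x \<bullet> rot \<phi> x)" "integrable lborel (\<lambda>x. \<phi> x \<bullet> rot g x)"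
    by (rule integrable_continuous_bounded_support[of _ R], intro continuous_intros cont,
        use R rot_\<phi>0 \<phi>0 in simp)+
  ultimately have int_eq: "(LINT x|lborel. g x \<bullet> rot \<phi> x) = (LINT x|lborel. rot g x \<bullet> \<phi> x)"
    by (simp add: inner_commute)
  have "x \<notin> K" if "x \<notin> \<Omega>" for x
    using that K(2) by blast
  then have ind: "indicator \<Omega> x * (g x \<bullet> rot \<phi> x) = g x \<bullet> rot \<phi> x"
    "indicator \<Omega> x * (rot g x \<bullet> \<phi> x) = rot g x \<bullet> \<phi> x" for x
    by (cases "x \<in> \<Omega>"; simp add: rot_\<phi>0 \<phi>0)+
  have "l2class \<Omega> g \<bullet> l2class \<Omega> (rot \<phi>) = l2class \<Omega> (rot g) \<bullet> l2class \<Omega> \<phi>"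
    by (simp only: inner_l2class sq cont ind int_eq)
  then show "l2class \<Omega> u \<bullet> l2class \<Omega> (rot \<phi>) = c *\<^sub>R l2class \<Omega> u \<bullet> l2class \<Omega> \<phi>"
    by (simp add: class_u rot_g)
qed

lemma eigenvalue_in_Sp_rot:
  assumes \<Omega>: "open \<Omega>" and u: "smooth_upto_boundary \<Omega> u"
    and eigen: "\<And>x. x \<in> \<Omega> \<Longrightarrow> rot u x = c *\<^sub>R u x"
    and trace: "normal_trace_zero \<Omega> u" and nz: "l2class \<Omega> u \<noteq> 0"
  shows "c \<in> Sp_rot \<Omega>"
proof -
  obtain g where g: "smooth_on UNIV g" and ug: "\<And>x. x \<in> closure \<Omega> \<Longrightarrow> u x = g x"
    using u by (auto simp: smooth_upto_boundary_def)
  have "Ck 1 \<Omega> g"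
    using Ck_subset[OF smooth_on_Ck1[OF g], of \<Omega>] by (simp only: One_nat_def subset_UNIV)
  then have "Ck 1 \<Omega> u"
    by (rule Ck_cong[OF \<Omega>, rotated]) (use ug closure_subset in \<open>metis subsetD\<close>)
  moreover have "continuous_on (closure \<Omega>) u"
    using continuous_on_subset[OF smooth_on_continuous_on[OF g], of "closure \<Omega>"] ug
    by (simp cong: continuous_on_cong)
  moreover have "\<exists>x\<in>\<Omega>. u x \<noteq> 0"
    using l2class_eq_0 nz by blast
  ultimately show ?thesis
    unfolding Sp_rot_def using eigen trace by blast
qed

section \<open>Potentials concentrated in a small ball\<close>

lemma smooth_on_add:
  "open S \<Longrightarrow> smooth_on S f \<Longrightarrow> smooth_on S g \<Longrightarrow> smooth_on S (\<lambda>x. f x + g x)"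
  by (simp add: smooth_on_def Ck_add)

lemma smooth_on_bounded_linear:
  "open S \<Longrightarrow> bounded_linear L \<Longrightarrow> smooth_on S f \<Longrightarrow> smooth_on S (\<lambda>x. L (f x))"
  by (simp add: smooth_on_def Ck_bounded_linear)

lemma partial_deriv_scaleR_left:
  assumes "smooth_on UNIV \<psi>"
  shows "partial_deriv i (\<lambda>x. \<psi> x *\<^sub>R v) x = partial_deriv i \<psi> x *\<^sub>R v"
  unfolding partial_deriv_def[of i \<psi>]
  by (rule partial_deriv_eqI)
    (intro bounded_linear.has_derivative[OF bounded_linear_scaleR_left] smooth_on_has_derivative[OF assms] UNIV_I)

lemma partial_deriv_add:
  assumes "smooth_on UNIV f" "smooth_on UNIV g"
  shows "partial_deriv i (\<lambda>x. f x + g x) x = partial_deriv i f x + partial_deriv i g x"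
  unfolding partial_deriv_def[of i f] partial_deriv_def[of i g]
  by (intro partial_deriv_eqI has_derivative_add smooth_on_has_derivative[OF assms(1) UNIV_I]
      smooth_on_has_derivative[OF assms(2) UNIV_I])

text \<open>The potential is shrunk by the factor \<open>s\<close> and moved to \<open>a\<close>; a
  support of radius 2 becomes one of radius \<open>2 * s\<close> inside the domain. One fixed scale
  shows that 0 is in the spectrum, and varying scales show that the rotation is unbounded.\<close>

locale scaled_potential =
  fixes \<psi>\<^sub>0 :: "real^3 \<Rightarrow> real" and \<Omega> :: "(real^3) set" and a :: "real^3" and s :: real
  assumes smooth0: "smooth_on UNIV \<psi>\<^sub>0" and supp0: "\<And>x. 2 < norm x \<Longrightarrow> \<psi>\<^sub>0 x = 0"
    and commute0: "\<And>i j. partial_deriv i (partial_deriv j \<psi>\<^sub>0) = partial_deriv j (partial_deriv i \<psi>\<^sub>0)"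
    and s: "0 < s" and cball: "cball a (2 * s) \<subseteq> \<Omega>" and \<Omega>: "open \<Omega>" "bounded \<Omega>"
begin

definition \<psi> :: "real^3 \<Rightarrow> real" where "\<psi> x = \<psi>\<^sub>0 ((1 / s) *\<^sub>R (x - a))"

lemma smooth: "smooth_on UNIV \<psi>"
  using smooth0 unfolding smooth_on_def \<psi>_def by (blast intro: Ck_compose_homothety)

lemma partial: "partial_deriv i \<psi> x = (1 / s) * partial_deriv i \<psi>\<^sub>0 ((1 / s) *\<^sub>R (x - a))"
  unfolding \<psi>_def
  by (subst partial_deriv_homothety)
    (auto intro: differentiableI smooth_on_has_derivative[OF smooth0])

lemma partial2:
  "partial_deriv i (partial_deriv j \<psi>) x
    = (1 / s)\<^sup>2 * partial_deriv i (partial_deriv j \<psi>\<^sub>0) ((1 / s) *\<^sub>R (x - a))"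
proof -
  let ?g = "partial_deriv j \<psi>\<^sub>0"
  have g: "smooth_on UNIV ?g"
    using smooth0 by (rule smooth_on_partial_deriv)
  then have *: "smooth_on UNIV (\<lambda>x. ?g ((1 / s) *\<^sub>R (x - a)))"
    unfolding smooth_on_def by (blast intro: Ck_compose_homothety)
  have "partial_deriv i (\<lambda>x. (1 / s) *\<^sub>R ?g ((1 / s) *\<^sub>R (x - a))) x
      = (1 / s) *\<^sub>R partial_deriv i (\<lambda>x. ?g ((1 / s) *\<^sub>R (x - a))) x"
    unfolding partial_deriv_def[of i "\<lambda>x. ?g ((1 / s) *\<^sub>R (x - a))"]
    by (intro partial_deriv_eqI bounded_linear.has_derivative[OF bounded_linear_scaleR_right]
        smooth_on_has_derivative[OF * UNIV_I])
  also have "partial_deriv i (\<lambda>x. ?g ((1 / s) *\<^sub>R (x - a))) x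
      = (1 / s) *\<^sub>R partial_deriv i ?g ((1 / s) *\<^sub>R (x - a))"
    by (rule partial_deriv_homothety)
      (auto intro: differentiableI smooth_on_has_derivative[OF g])
  finally show ?thesis
    by (simp add: partial[abs_def] power2_eq_square)
qed

lemma commute: "partial_deriv i (partial_deriv j \<psi>) x = partial_deriv j (partial_deriv i \<psi>) x"
  by (simp add: partial2 commute0[of i j])

lemma supp: "\<psi> x = 0" if "x \<notin> cball a (2 * s)"
proof -
  have "2 * s < norm (x - a)"
    using that by (simp add: dist_norm norm_minus_commute)
  then show ?thesis
    using s unfolding \<psi>_def by (intro supp0) (simp add: pos_less_divide_eq)
qed

lemma supp_partial: "partial_deriv i \<psi> x = 0" if "x \<notin> cball a (2 * s)"
  by (rule partial_deriv_eq_0[of "- cball a (2 * s)"]) (use that supp in auto)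

text \<open>The eigenfield is the gradient of \<open>\<psi>\<close>, written as a sum over the axes.
  Its rotation vanishes because mixed partial derivatives commute, and the trace condition holds
  whatever the normal is, since the field is zero on the frontier.\<close>

lemma zero_in_Sp_rot:
  assumes "partial_deriv 1 \<psi>\<^sub>0 y \<noteq> 0"
  shows "0 \<in> Sp_rot \<Omega>"
proof -
  let ?u = "\<lambda>x. \<Sum>i\<in>UNIV. partial_deriv i \<psi> x *\<^sub>R (axis i 1 :: real^3)"
  have smooth_term: "smooth_on UNIV (\<lambda>x. partial_deriv i \<psi> x *\<^sub>R (axis i 1 :: real^3))" for i
    by (intro smooth_on_bounded_linear[OF open_UNIV bounded_linear_scaleR_left] smooth_on_partial_deriv smooth)
  have u: "smooth_on UNIV ?u"
    unfolding sum_3 by (intro smooth_on_add open_UNIV smooth_term)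
  have "partial_deriv j ?u x = (\<Sum>i\<in>UNIV. partial_deriv j (partial_deriv i \<psi>) x *\<^sub>R axis i 1)" for j x
    unfolding sum_3
    by (simp add: partial_deriv_add smooth_term smooth_on_add partial_deriv_scaleR_left
        smooth_on_partial_deriv smooth)
  then have "rot ?u x = 0" for x
    by (simp add: rot_def sum_3 axis_def vec_eq_iff forall_3 commute[of 1 2] commute[of 1 3] commute[of 2 3])
  moreover have "Ck 1 \<Omega> ?u"
    using Ck_subset[OF smooth_on_Ck1[OF u], of \<Omega>] by (simp only: One_nat_def subset_UNIV)
  moreover have "continuous_on (closure \<Omega>) ?u"
    using continuous_on_subset[OF smooth_on_continuous_on[OF u]] by blast
  moreover have "normal_trace_zero \<Omega> ?u"
    unfolding normal_trace_zero_def
  proof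
    fix x assume "x \<in> frontier \<Omega>"
    then have "x \<notin> cball a (2 * s)"
      using cball \<Omega>(1) by (auto simp: frontier_def interior_open)
    then have "partial_deriv i \<psi> x = 0" for i
      by (rule supp_partial)
    then show "unit_normal \<Omega> x \<bullet> ?u x = 0"
      by simp
  qed
  moreover have "\<exists>x\<in>\<Omega>. ?u x \<noteq> 0"
  proof
    \<comment> \<open>This point is sent back to \<open>y\<close> by the rescaling. The partial
      derivative does not vanish there, so the point lies in the supporting ball and thus in the
      domain.\<close>
    let ?x = "a + s *\<^sub>R y"
    have nz: "partial_deriv 1 \<psi> ?x \<noteq> 0"
      using assms s by (simp add: partial)
    moreover have "?u ?x $ 1 = partial_deriv 1 \<psi> ?x"
      by (simp add: sum_3 axis_def)
    ultimately show "?u ?x \<noteq> 0"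
      by force
    show "?x \<in> \<Omega>"
      using nz supp_partial cball by blast
  qed
  ultimately show ?thesis
    unfolding Sp_rot_def by auto
qed

text \<open>A vector potential along one axis: its rotation is
  \<open>(\<partial>\<^sub>2\<psi>, - \<partial>\<^sub>1\<psi>, 0)\<close>, a divergence-free field
  whose norm is explicit.\<close>

definition vpot :: "real^3 \<Rightarrow> real^3" where "vpot x = \<psi> x *\<^sub>R axis 3 1"

lemma rot_vpot: "rot vpot x = partial_deriv 2 \<psi> x *\<^sub>R axis 1 1 + partial_deriv 1 \<psi> x *\<^sub>R (- axis 2 1)"
  unfolding rot_def vpot_def[abs_def] partial_deriv_scaleR_left[OF smooth]
  by (simp add: vec_eq_iff forall_3 axis_def)

lemma smooth_rot_vpot: "smooth_on UNIV (rot vpot)"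
  unfolding rot_vpot[abs_def]
  by (intro smooth_on_add open_UNIV smooth_on_bounded_linear[OF open_UNIV bounded_linear_scaleR_left]
      smooth_on_partial_deriv smooth)

lemma vpot_test_field: "vpot \<in> test_fields \<Omega>"
  by (rule test_fieldsI[OF _ _ cball], unfold vpot_def[abs_def],
      intro smooth_on_bounded_linear[OF open_UNIV bounded_linear_scaleR_left] smooth)
    (auto simp: supp)

lemma rot_vpot_test_field: "rot vpot \<in> test_fields \<Omega>"
  by (rule test_fieldsI[OF smooth_rot_vpot _ cball]) (auto simp: rot_vpot supp_partial)

text \<open>The field is itself a test field with zero divergence, so the definition of the weak
  gradient yields orthogonality to all gradients directly.\<close>

lemma rot_vpot_in_V0: "l2class \<Omega> (rot vpot) \<in> V0 \<Omega>"
proof -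
  have smooth_term: "smooth_on UNIV (\<lambda>x. partial_deriv i \<psi> x *\<^sub>R (v :: real^3))" for i v
    by (intro smooth_on_bounded_linear[OF open_UNIV bounded_linear_scaleR_left] smooth_on_partial_deriv smooth)
  have "partial_deriv i (rot vpot) x = partial_deriv i (partial_deriv 2 \<psi>) x *\<^sub>R axis 1 1 +
      partial_deriv i (partial_deriv 1 \<psi>) x *\<^sub>R (- axis 2 1)" for i x
    unfolding rot_vpot[abs_def]
    by (simp only: partial_deriv_add smooth_term partial_deriv_scaleR_left smooth_on_partial_deriv smooth)
  then have "divergence (rot vpot) x = 0" for x
    by (simp add: divergence_def sum_3 axis_def commute[of 1 2])
  then have "F \<bullet> l2class \<Omega> (rot vpot) = 0" if "weak_gradient \<Omega> h F" for h F
    using that rot_vpot_test_field by (auto simp: weak_gradient_def)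
  then show ?thesis
    by (auto simp: V0_def L2_def orthogonal_comp_def orthogonal_def gradient_fields_def)
qed

lemma norm_l2class_support:
  assumes "continuous_on UNIV f" "\<And>x. x \<notin> cball a (2 * s) \<Longrightarrow> f x = 0"
  shows "(norm (l2class \<Omega> f))\<^sup>2 = (LINT x|lborel. f x \<bullet> f x)"
proof -
  have outside: "f x = 0" if "x \<notin> \<Omega>" for x
    using assms(2)[of x] cball that by blast
  have "(norm (l2class \<Omega> f))\<^sup>2 = (LINT x|lborel. indicator \<Omega> x * (f x \<bullet> f x))"
    unfolding power2_norm_eq_inner
    by (intro inner_l2class sq_integrable_restrict \<Omega> assms)
  also have "\<dots> = (LINT x|lborel. f x \<bullet> f x)"
    by (intro Bochner_Integration.integral_cong) (auto simp: indicator_def outside)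
  finally show ?thesis .
qed

lemma norm_vpot: "(norm (l2class \<Omega> vpot))\<^sup>2 = s ^ 3 * (LINT x|lborel. (\<psi>\<^sub>0 x)\<^sup>2)"
proof -
  have "(norm (l2class \<Omega> vpot))\<^sup>2 = (LINT x|lborel. vpot x \<bullet> vpot x)"
    by (rule norm_l2class_support)
      (use smooth_on_continuous_on[OF smooth] in \<open>auto simp: vpot_def[abs_def] supp intro!: continuous_intros\<close>)
  also have "\<dots> = (LINT x|lborel. (\<psi>\<^sub>0 ((1 / s) *\<^sub>R (x - a)))\<^sup>2)"
    by (simp add: vpot_def \<psi>_def power2_eq_square inner_axis_axis)
  also have "\<dots> = s ^ DIM(real^3) * (LINT x|lborel. (\<psi>\<^sub>0 x)\<^sup>2)"
    by (rule lborel_integral_homothety[of "\<lambda>x. (\<psi>\<^sub>0 x)\<^sup>2", OF _ s])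
      (use smooth_on_continuous_on[OF smooth0] in
        \<open>auto intro!: borel_measurable_continuous_onI continuous_intros\<close>)
  finally show ?thesis by simp
qed

text \<open>The derivative contributes \<open>1 / s\<close>, which is squared, against the volume
  factor \<open>s ^ 3\<close>; one power of \<open>s\<close> remains.\<close>

lemma norm_rot_vpot: "(norm (l2class \<Omega> (rot vpot)))\<^sup>2 =
    s * (LINT x|lborel. (partial_deriv 1 \<psi>\<^sub>0 x)\<^sup>2 + (partial_deriv 2 \<psi>\<^sub>0 x)\<^sup>2)"
proof -
  let ?f = "\<lambda>x. (partial_deriv 1 \<psi>\<^sub>0 x)\<^sup>2 + (partial_deriv 2 \<psi>\<^sub>0 x)\<^sup>2"
  have "(norm (l2class \<Omega> (rot vpot)))\<^sup>2 = (LINT x|lborel. rot vpot x \<bullet> rot vpot x)"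
    by (rule norm_l2class_support)
      (use smooth_on_continuous_on[OF smooth_rot_vpot] in \<open>auto simp: rot_vpot supp_partial\<close>)
  also have "\<dots> = (LINT x|lborel. (1 / s)\<^sup>2 * ?f ((1 / s) *\<^sub>R (x - a)))"
    by (simp add: rot_vpot partial inner_axis_axis inner_add_left inner_add_right
        power2_eq_square algebra_simps)
  also have "\<dots> = (1 / s)\<^sup>2 * (LINT x|lborel. ?f ((1 / s) *\<^sub>R (x - a)))"
    by simp
  also have "(LINT x|lborel. ?f ((1 / s) *\<^sub>R (x - a))) = s ^ DIM(real^3) * (LINT x|lborel. ?f x)"
    by (rule lborel_integral_homothety[of ?f, OF _ s])
      (intro borel_measurable_continuous_onI continuous_intros smooth_on_continuous_on
        smooth_on_partial_deriv smooth0)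
  finally show ?thesis
    using s by (simp add: power2_eq_square power3_eq_cube)
qed

end

lemma zero_in_Sp_rot:
  assumes "open \<Omega>" "bounded \<Omega>" "\<Omega> \<noteq> {}"
  shows "0 \<in> Sp_rot \<Omega>"
proof -
  obtain a r where "a \<in> \<Omega>" "0 < r" and r: "cball a r \<subseteq> \<Omega>"
    using assms open_contains_cball by blast
  obtain \<psi> :: "real^3 \<Rightarrow> real" where \<psi>: "smooth_on UNIV \<psi>" "\<forall>x. 2 < norm x \<longrightarrow> \<psi> x = 0"
    "\<forall>i j. partial_deriv i (partial_deriv j \<psi>) = partial_deriv j (partial_deriv i \<psi>)"
    and "\<exists>y. partial_deriv 1 \<psi> y \<noteq> 0"
    using smooth_potential by blast
  then obtain y where y: "partial_deriv 1 \<psi> y \<noteq> 0" by blast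
  interpret scaled_potential \<psi> \<Omega> a "r / 2"
    using assms \<psi> \<open>0 < r\<close> r by unfold_locales auto
  show ?thesis using y by (rule zero_in_Sp_rot)
qed

text \<open>At scale \<open>s\<close> the rotation of the concentrated potential is larger than the potential itself
  by a factor of order \<open>1 / s\<close>.\<close>

lemma weak_rot_unbounded_on_V0:
  assumes \<Omega>: "open \<Omega>" "bounded \<Omega>" "\<Omega> \<noteq> {}"
  shows "\<exists>w\<in>V0 \<Omega>. \<forall>v. weak_rot \<Omega> w v \<longrightarrow> M * norm w < norm v"
proof (rule ccontr)
  assume "\<not> ?thesis"
  then have bounded: "\<exists>v. weak_rot \<Omega> w v \<and> norm v \<le> M * norm w" if "w \<in> V0 \<Omega>" for w
    using that by (meson not_le)
  obtain a r where "a \<in> \<Omega>" "0 < r" and r: "cball a r \<subseteq> \<Omega>"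
    using \<Omega> open_contains_cball by blast
  obtain \<psi> :: "real^3 \<Rightarrow> real" where \<psi>: "smooth_on UNIV \<psi>" "\<forall>x. 2 < norm x \<longrightarrow> \<psi> x = 0"
    "\<forall>i j. partial_deriv i (partial_deriv j \<psi>) = partial_deriv j (partial_deriv i \<psi>)"
    and "\<exists>y. partial_deriv 1 \<psi> y \<noteq> 0"
    using smooth_potential by blast
  then obtain y where y: "partial_deriv 1 \<psi> y \<noteq> 0" by blast
  let ?f = "\<lambda>x. (partial_deriv 1 \<psi> x)\<^sup>2 + (partial_deriv 2 \<psi> x)\<^sup>2"
  define A where "A = (LINT x|lborel. ?f x)"
  define B where "B = (LINT x|lborel. (\<psi> x)\<^sup>2)"
  have le: "A \<le> M\<^sup>2 * s\<^sup>2 * B" if s: "0 < s" "s \<le> r / 2" for s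
  proof -
    interpret scaled_potential \<psi> \<Omega> a s
    proof
      have "cball a (2 * s) \<subseteq> cball a r"
        using s(2) by (intro subset_cball) simp
      then show "cball a (2 * s) \<subseteq> \<Omega>"
        using r by blast
    qed (use \<psi> s(1) \<Omega> in \<open>simp_all\<close>)
    let ?w = "l2class \<Omega> (rot vpot)" and ?\<phi> = "l2class \<Omega> vpot"
    obtain v where v: "weak_rot \<Omega> ?w v" "norm v \<le> M * norm ?w"
      using bounded[OF rot_vpot_in_V0] by blast
    \<comment> \<open>\<open>?w\<close> is the class of the rotation of \<open>vpot\<close>, so the
      left side is the weak rotation identity tested with \<open>vpot\<close>.\<close>
    have "(norm ?w)\<^sup>2 = v \<bullet> ?\<phi>"
      using v(1) vpot_test_field by (auto simp: weak_rot_def power2_norm_eq_inner)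
    also have "\<dots> \<le> norm v * norm ?\<phi>"
      by (rule norm_cauchy_schwarz)
    also have "\<dots> \<le> M * norm ?w * norm ?\<phi>"
      using v(2) by (rule mult_right_mono) simp
    finally have "norm ?w * norm ?w \<le> norm ?w * (M * norm ?\<phi>)"
      by (simp add: power2_eq_square mult_ac)
    \<comment> \<open>One factor \<open>norm ?w\<close> is cancelled. The absolute value keeps the
      bound usable for squaring when \<open>M\<close> is negative.\<close>
    then have "norm ?w \<le> \<bar>M * norm ?\<phi>\<bar>"
      by (cases "norm ?w = 0") (auto simp: mult_le_cancel_left)
    then have "(norm ?w)\<^sup>2 \<le> (M * norm ?\<phi>)\<^sup>2"
      by (metis norm_ge_zero power2_abs power_mono)
    then have "s * A \<le> M\<^sup>2 * (s ^ 3 * B)"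
      by (simp only: power_mult_distrib norm_vpot norm_rot_vpot A_def B_def)
    then have "s * A \<le> s * (M\<^sup>2 * s\<^sup>2 * B)"
      by (simp add: power2_eq_square power3_eq_cube mult_ac)
    then show ?thesis
      using s by (simp add: mult_le_cancel_left)
  qed
  have smooth_d: "smooth_on UNIV (partial_deriv i \<psi>)" for i
    using \<psi>(1) by (rule smooth_on_partial_deriv)
  have "0 < A"
    unfolding A_def
  proof (rule integral_pos_if_continuous)
    show cont: "continuous_on UNIV ?f"
      by (intro continuous_intros smooth_on_continuous_on smooth_d)
    have "partial_deriv i \<psi> x = 0" if "2 < norm x" for i x
      by (rule partial_deriv_eq_0[OF open_norm_greater, of _ 2]) (use that \<psi>(2) in auto)
    then show "integrable lborel ?f"
      by (intro integrable_continuous_bounded_support[OF cont, of 2]) simp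
    show "?f y \<noteq> 0"
      using y by (simp add: sum_power2_eq_zero_iff)
  qed simp
  \<comment> \<open>\<open>A\<close> and \<open>B\<close> do not depend on \<open>s\<close>, so the
    estimate may be taken to the limit at 0 from the right.\<close>
  moreover have "A \<le> 0"
  proof (rule tendsto_lowerbound)
    show "((\<lambda>s. M\<^sup>2 * s\<^sup>2 * B) \<longlongrightarrow> 0) (at_right 0)"
      by (auto intro!: tendsto_eq_intros)
    show "\<forall>\<^sub>F s in at_right 0. A \<le> M\<^sup>2 * s\<^sup>2 * B"
      unfolding eventually_at_right_field
      using le \<open>0 < r\<close> by (intro exI[of _ "r / 2"]) auto
  qed simp
  ultimately show False by simp
qed

section \<open>Weighted coefficient spaces and the multiplier\<close>

text \<open>Minkowski's inequality for square summable sequences, as a limit of the finite one for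
  \<open>L2_set\<close>. Domination of \<open>z\<close> by \<open>x + y\<close>, in place of
  equality, fits weighted absolute values as well as norms of coefficient pairs.\<close>

lemma sqrt_suminf_triangle:
  fixes x y z :: "nat \<Rightarrow> real"
  assumes sx: "summable (\<lambda>j. (x j)\<^sup>2)" and sy: "summable (\<lambda>j. (y j)\<^sup>2)"
    and nonneg: "\<And>j. 0 \<le> z j" and le: "\<And>j. z j \<le> x j + y j"
  shows "summable (\<lambda>j. (z j)\<^sup>2)"
    and "sqrt (\<Sum>j. (z j)\<^sup>2) \<le> sqrt (\<Sum>j. (x j)\<^sup>2) + sqrt (\<Sum>j. (y j)\<^sup>2)"
proof -
  let ?C = "sqrt (\<Sum>j. (x j)\<^sup>2) + sqrt (\<Sum>j. (y j)\<^sup>2)"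
  have C: "0 \<le> ?C"
    by (intro add_nonneg_nonneg real_sqrt_ge_zero suminf_nonneg sx sy) auto
  have bound: "(\<Sum>j<n. (z j)\<^sup>2) \<le> ?C\<^sup>2" for n
  proof -
    have "L2_set z {..<n} \<le> L2_set (\<lambda>j. x j + y j) {..<n}"
      using nonneg le by (intro L2_set_mono) auto
    also have "\<dots> \<le> L2_set x {..<n} + L2_set y {..<n}"
      by (rule L2_set_triangle_ineq)
    also have "\<dots> \<le> ?C"
      unfolding L2_set_def by (intro add_mono real_sqrt_le_mono sum_le_suminf sx sy) auto
    finally have "(L2_set z {..<n})\<^sup>2 \<le> ?C\<^sup>2"
      by (intro power_mono) (auto simp: L2_set_def sum_nonneg)
    then show ?thesis
      by (simp add: L2_set_def sum_nonneg)
  qed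
  show *: "summable (\<lambda>j. (z j)\<^sup>2)"
    using bound by (intro summableI_nonneg_bounded) auto
  have "(\<Sum>j. (z j)\<^sup>2) \<le> ?C\<^sup>2"
    using bound by (intro suminf_le_const *)
  then show "sqrt (\<Sum>j. (z j)\<^sup>2) \<le> ?C"
    using C by (intro real_le_lsqrt) auto
qed

lemma sqrt_suminf_scale:
  fixes x y :: "nat \<Rightarrow> real"
  assumes "summable y" "\<And>j. 0 \<le> x j" "\<And>j. x j \<le> K\<^sup>2 * y j" "0 \<le> K"
  shows "summable x" "sqrt (suminf x) \<le> K * sqrt (suminf y)"
proof -
  show *: "summable x"
    by (rule summable_comparison_test'[OF summable_mult[OF assms(1), of "K\<^sup>2"], of 0]) (use assms in simp)
  have "suminf x \<le> (\<Sum>j. K\<^sup>2 * y j)"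
    using assms by (intro suminf_le summable_mult *) auto
  also have "\<dots> = K\<^sup>2 * suminf y"
    using assms(1) by (rule suminf_mult)
  finally have "sqrt (suminf x) \<le> sqrt (K\<^sup>2 * suminf y)"
    by (rule real_sqrt_le_mono)
  then show "sqrt (suminf x) \<le> K * sqrt (suminf y)"
    using assms(4) by (simp add: real_sqrt_mult)
qed

lemma sqrt_suminf_eq_0_iff:
  fixes x :: "nat \<Rightarrow> real"
  assumes "summable x" "\<And>j. 0 \<le> x j"
  shows "sqrt (suminf x) = 0 \<longleftrightarrow> (\<forall>j. x j = 0)"
  using suminf_eq_zero_iff[OF assms] by simp

lemma continuous_map_Lipschitz:
  assumes "Metric_space M1 d1" "Metric_space M2 d2" "f ` M1 \<subseteq> M2"
    and L: "\<And>x y. x \<in> M1 \<Longrightarrow> y \<in> M1 \<Longrightarrow> d2 (f x) (f y) \<le> L * d1 x y"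
  shows "continuous_map (Metric_space.mtopology M1 d1) (Metric_space.mtopology M2 d2) f"
  unfolding Metric_space.metric_continuous_map[OF assms(1,2)]
proof (intro conjI ballI allI impI assms(3))
  interpret M1: Metric_space M1 d1 by fact
  fix a and e :: real assume a: "a \<in> M1" and e: "0 < e"
  \<comment> \<open>The divisor \<open>\<bar>L\<bar> + 1\<close> is positive whatever the value of
    \<open>L\<close>.\<close>
  have "d2 (f a) (f x) < e" if "x \<in> M1" "d1 a x < e / (\<bar>L\<bar> + 1)" for x
  proof -
    have "d2 (f a) (f x) \<le> L * d1 a x"
      using L a that(1) .
    also have "\<dots> \<le> (\<bar>L\<bar> + 1) * d1 a x"
      by (intro mult_right_mono) auto
    also have "\<dots> < e"
      using that(2) by (simp add: pos_less_divide_eq mult.commute)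
    finally show ?thesis .
  qed
  then show "\<exists>\<delta>>0. \<forall>x. x \<in> M1 \<and> d1 a x < \<delta> \<longrightarrow> d2 (f a) (f x) < e"
    using e by (intro exI[of _ "e / (\<bar>L\<bar> + 1)"]) auto
qed

section \<open>The gradient component: weighted coefficient sequences\<close>

context
  fixes \<nu> :: "nat \<Rightarrow> real" and k :: int
  assumes \<nu>: "\<And>j. 0 < \<nu> j"
begin

lemma A_term_eq: "\<nu> j powi (4 * k) * (a j)\<^sup>2 = (sqrt (\<nu> j powi (4 * k)) * \<bar>a j\<bar>)\<^sup>2"
  using \<nu>[of j] by (simp add: power_mult_distrib)

lemma A_triangle:
  assumes "a \<in> A_space \<nu> k" "b \<in> A_space \<nu> k" "\<And>j. \<bar>d j\<bar> \<le> \<bar>a j\<bar> + \<bar>b j\<bar>"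
  shows "d \<in> A_space \<nu> k" "A_norm \<nu> k d \<le> A_norm \<nu> k a + A_norm \<nu> k b"
proof -
  have "sqrt (\<nu> j powi (4 * k)) * \<bar>d j\<bar>
      \<le> sqrt (\<nu> j powi (4 * k)) * \<bar>a j\<bar> + sqrt (\<nu> j powi (4 * k)) * \<bar>b j\<bar>" for j
    using \<nu>[of j] assms(3)[of j] unfolding distrib_left[symmetric] by (intro mult_left_mono) auto
  note triangle = sqrt_suminf_triangle[OF _ _ _ this]
  show "d \<in> A_space \<nu> k" "A_norm \<nu> k d \<le> A_norm \<nu> k a + A_norm \<nu> k b"
    using assms(1,2) \<nu> unfolding A_space_def A_norm_def A_term_eq mem_Collect_eq
    by (auto intro: triangle simp: less_imp_le)
qed

lemma A_diff:
  assumes "a \<in> A_space \<nu> k" "b \<in> A_space \<nu> k"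
  shows "(\<lambda>j. a j - b j) \<in> A_space \<nu> k"
  using assms by (rule A_triangle(1)) (rule abs_triangle_ineq4)

lemma A_scale:
  assumes "a \<in> A_space \<nu> k" "\<And>j. \<bar>d j\<bar> \<le> L * \<bar>a j\<bar>" "0 \<le> L"
  shows "d \<in> A_space \<nu> k" "A_norm \<nu> k d \<le> L * A_norm \<nu> k a"
proof -
  have *: "\<nu> j powi (4 * k) * (d j)\<^sup>2 \<le> L\<^sup>2 * (\<nu> j powi (4 * k) * (a j)\<^sup>2)" for j
  proof -
    have "\<bar>d j\<bar>\<^sup>2 \<le> (L * \<bar>a j\<bar>)\<^sup>2"
      using assms(2) by (intro power_mono) auto
    then have "\<nu> j powi (4 * k) * (d j)\<^sup>2 \<le> \<nu> j powi (4 * k) * (L\<^sup>2 * (a j)\<^sup>2)"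
      using \<nu>[of j] by (intro mult_left_mono) (auto simp: power_mult_distrib)
    then show ?thesis by (simp add: mult_ac)
  qed
  show "d \<in> A_space \<nu> k" "A_norm \<nu> k d \<le> L * A_norm \<nu> k a"
    using sqrt_suminf_scale[OF _ _ * assms(3)] assms(1) \<nu>
    by (auto simp: A_space_def A_norm_def less_imp_le)
qed

lemma A_norm_nonneg: "a \<in> A_space \<nu> k \<Longrightarrow> 0 \<le> A_norm \<nu> k a"
  using \<nu> by (auto simp: A_space_def A_norm_def less_imp_le intro!: suminf_nonneg)

lemma A_norm_diff_eq_0_iff:
  assumes "a \<in> A_space \<nu> k" "b \<in> A_space \<nu> k"
  shows "A_norm \<nu> k (\<lambda>j. a j - b j) = 0 \<longleftrightarrow> a = b"
proof -
  have "A_norm \<nu> k (\<lambda>j. a j - b j) = 0 \<longleftrightarrow> (\<forall>j. \<nu> j powi (4 * k) * (a j - b j)\<^sup>2 = 0)"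
    unfolding A_norm_def using A_diff[OF assms] \<nu>
    by (intro sqrt_suminf_eq_0_iff) (auto simp: A_space_def less_imp_le)
  also have "\<dots> \<longleftrightarrow> (\<forall>j. a j = b j)"
    using \<nu> by (simp add: less_imp_neq[symmetric])
  finally show ?thesis
    by (simp add: fun_eq_iff)
qed

lemma A_norm_diff_triangle:
  assumes "a \<in> A_space \<nu> k" "b \<in> A_space \<nu> k" "d \<in> A_space \<nu> k"
  shows "A_norm \<nu> k (\<lambda>j. a j - d j) \<le> A_norm \<nu> k (\<lambda>j. a j - b j) + A_norm \<nu> k (\<lambda>j. b j - d j)"
proof (rule A_triangle(2))
  show "\<bar>a j - d j\<bar> \<le> \<bar>a j - b j\<bar> + \<bar>b j - d j\<bar>" for j
    by linarith
qed (rule A_diff assms)+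

end

section \<open>The \<open>V0\<close> component: the multiplier between consecutive orders\<close>

locale rot_multiplier =
  diagonal_self_adjoint "\<lambda>j. l2class \<Omega> (qp j)" "\<lambda>j. l2class \<Omega> (qm j)" "V0 \<Omega>" "S_graph \<Omega>" \<mu>
  for \<Omega> :: "(real^3) set" and qp qm :: "nat \<Rightarrow> field" and \<mu> :: "nat \<Rightarrow> real" +
  fixes c \<delta> :: real
  assumes mu: "\<And>j. 0 < \<mu> j" "incseq \<mu>"
    and \<delta>: "0 < \<delta>" "\<And>j. \<delta> * \<mu> j \<le> \<bar>\<mu> j + c\<bar>" "\<And>j. \<delta> * \<mu> j \<le> \<bar>- \<mu> j + c\<bar>"
begin

abbreviation P :: "nat \<Rightarrow> l2" where "P j \<equiv> l2class \<Omega> (qp j)"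
abbreviation N :: "nat \<Rightarrow> l2" where "N j \<equiv> l2class \<Omega> (qm j)"
abbreviation W :: "nat \<Rightarrow> l2 \<Rightarrow> nat \<Rightarrow> real" where "W \<equiv> W_term \<Omega> \<mu> qp qm"
abbreviation Wspace :: "nat \<Rightarrow> l2 set" where "Wspace \<equiv> W_space \<Omega> \<mu> qp qm"
abbreviation Wnorm :: "nat \<Rightarrow> l2 \<Rightarrow> real" where "Wnorm \<equiv> W_norm \<Omega> \<mu> qp qm"

lemma W_nonneg: "0 \<le> W m w j"
  using mu(1)[of j] by (simp add: W_term_def)

lemma W_eq: "W m w j = (\<mu> j ^ m * norm (w \<bullet> P j, w \<bullet> N j))\<^sup>2"
  by (simp add: W_term_def norm_prod_def power_mult_distrib power_mult power2_eq_square power_mult[symmetric] mult.commute)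

lemma W_triangle:
  assumes "v \<in> Wspace m" "w \<in> Wspace m"
  shows "v + w \<in> Wspace m" "Wnorm m (v + w) \<le> Wnorm m v + Wnorm m w"
proof -
  have "norm ((v + w) \<bullet> P j, (v + w) \<bullet> N j) \<le> norm (v \<bullet> P j, v \<bullet> N j) + norm (w \<bullet> P j, w \<bullet> N j)" for j
    using norm_triangle_ineq[of "(v \<bullet> P j, v \<bullet> N j)" "(w \<bullet> P j, w \<bullet> N j)"]
    by (simp add: inner_add_left)
  then have "\<mu> j ^ m * norm ((v + w) \<bullet> P j, (v + w) \<bullet> N j)
      \<le> \<mu> j ^ m * norm (v \<bullet> P j, v \<bullet> N j) + \<mu> j ^ m * norm (w \<bullet> P j, w \<bullet> N j)" for j
    unfolding distrib_left[symmetric] using mu(1)[of j] by (intro mult_left_mono) auto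
  note tri = sqrt_suminf_triangle[OF _ _ _ this]
  have "summable (W m (v + w)) \<and> Wnorm m (v + w) \<le> Wnorm m v + Wnorm m w"
    unfolding W_norm_def W_eq[abs_def]
    by (rule conjI; rule tri)
      (use assms mu(1) in \<open>auto simp: W_space_def W_eq[abs_def] less_imp_le\<close>)
  then show "v + w \<in> Wspace m" "Wnorm m (v + w) \<le> Wnorm m v + Wnorm m w"
    using assms subspace_add[OF subspace_H] by (auto simp: W_space_def)
qed

lemma W_minus: "W m (- w) = W m w"
  by (simp add: W_term_def fun_eq_iff)

lemma W_diff: "v \<in> Wspace m \<Longrightarrow> w \<in> Wspace m \<Longrightarrow> v - w \<in> Wspace m"
  using W_triangle(1)[of v m "- w"] subspace_neg[OF subspace_H]
  by (auto simp: W_space_def W_minus)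

lemma Wnorm_nonneg: "w \<in> Wspace m \<Longrightarrow> 0 \<le> Wnorm m w"
  by (auto simp: W_space_def W_norm_def W_nonneg intro!: suminf_nonneg)

lemma Wnorm_diff_eq_0_iff:
  assumes "v \<in> Wspace m" "w \<in> Wspace m"
  shows "Wnorm m (v - w) = 0 \<longleftrightarrow> v = w"
proof -
  have "v - w \<in> Wspace m"
    using assms by (rule W_diff)
  then have vw: "v - w \<in> V0 \<Omega>" "summable (W m (v - w))"
    by (auto simp: W_space_def)
  have nz: "\<mu> j \<noteq> 0" for j
    using mu(1)[of j] by simp
  have "Wnorm m (v - w) = 0 \<longleftrightarrow> (\<forall>j. W m (v - w) j = 0)"
    unfolding W_norm_def by (rule sqrt_suminf_eq_0_iff[OF vw(2) W_nonneg])
  also have "\<dots> \<longleftrightarrow> (\<forall>j. (v - w) \<bullet> P j = 0 \<and> (v - w) \<bullet> N j = 0)"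
    by (simp add: W_term_def sum_power2_eq_zero_iff nz)
  also have "\<dots> \<longleftrightarrow> v - w = 0"
    using zero_if_coeffs_zero[OF vw(1)] by auto
  finally show ?thesis by simp
qed

lemma Wnorm_diff_triangle:
  assumes "u \<in> Wspace m" "v \<in> Wspace m" "w \<in> Wspace m"
  shows "Wnorm m (u - w) \<le> Wnorm m (u - v) + Wnorm m (v - w)"
  using W_triangle(2)[OF W_diff[OF assms(1,2)] W_diff[OF assms(2,3)]] by simp

text \<open>As \<open>\<mu> 0\<close> is the smallest of the \<open>\<mu> j\<close>, the shift
  satisfies \<open>\<bar>c\<bar> \<le> (\<bar>c\<bar> / \<mu> 0) * \<mu> j\<close>; the 1 accounts
  for \<open>\<mu> j\<close> itself.\<close>

definition K :: real where "K = 1 + \<bar>c\<bar> / \<mu> 0"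

lemma K_bound: "0 \<le> K" "\<bar>\<mu> j + c\<bar> \<le> K * \<mu> j" "\<bar>- \<mu> j + c\<bar> \<le> K * \<mu> j"
proof -
  show "0 \<le> K"
    using mu(1)[of 0] by (simp add: K_def)
  have "\<mu> 0 \<le> \<mu> j"
    using mu(2) by (simp add: incseq_def)
  then have "\<bar>c\<bar> * \<mu> 0 \<le> \<bar>c\<bar> * \<mu> j"
    by (intro mult_left_mono) auto
  then have "\<bar>c\<bar> \<le> \<bar>c\<bar> / \<mu> 0 * \<mu> j"
    using mu(1)[of 0] by (simp add: pos_le_divide_eq mult.commute)
  then show "\<bar>\<mu> j + c\<bar> \<le> K * \<mu> j" "\<bar>- \<mu> j + c\<bar> \<le> K * \<mu> j"
    using mu(1)[of j] by (auto simp: K_def distrib_right)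
qed

text \<open>Passing from \<open>m\<close> to \<open>m + 1\<close> adds the weight
  \<open>(\<mu> j)\<^sup>2\<close>, which is what the squared multiplier is comparable to. Only the
  relation between coefficients is assumed, so the estimates serve images, preimages and differences
  alike.\<close>

lemma W_multiplier:
  assumes "\<And>j. g \<bullet> P j = (\<mu> j + c) * (w \<bullet> P j)" "\<And>j. g \<bullet> N j = (- \<mu> j + c) * (w \<bullet> N j)"
  shows "W m g j \<le> K\<^sup>2 * W (m + 1) w j" "W (m + 1) w j \<le> (1 / \<delta>)\<^sup>2 * W m g j"
proof -
  let ?a = "(w \<bullet> P j)\<^sup>2" and ?b = "(w \<bullet> N j)\<^sup>2"
  have g: "W m g j = \<mu> j ^ (2 * m) * ((\<mu> j + c)\<^sup>2 * ?a + (- \<mu> j + c)\<^sup>2 * ?b)"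
    by (simp add: W_term_def assms power_mult_distrib)
  have w: "W (m + 1) w j = \<mu> j ^ (2 * m) * ((\<mu> j)\<^sup>2 * ?a + (\<mu> j)\<^sup>2 * ?b)"
    by (simp add: W_term_def power_add power2_eq_square distrib_left mult.assoc)
  have up: "(\<mu> j + c)\<^sup>2 \<le> K\<^sup>2 * (\<mu> j)\<^sup>2" "(- \<mu> j + c)\<^sup>2 \<le> K\<^sup>2 * (\<mu> j)\<^sup>2"
    using power_mono[OF K_bound(2)[of j], of 2] power_mono[OF K_bound(3)[of j], of 2]
    by (simp_all add: power_mult_distrib)
  have "0 \<le> \<delta> * \<mu> j"
    using \<delta>(1) mu(1)[of j] by simp
  then have low: "\<delta>\<^sup>2 * (\<mu> j)\<^sup>2 \<le> (\<mu> j + c)\<^sup>2" "\<delta>\<^sup>2 * (\<mu> j)\<^sup>2 \<le> (- \<mu> j + c)\<^sup>2"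
    using power_mono[OF \<delta>(2)[of j], of 2] power_mono[OF \<delta>(3)[of j], of 2]
    by (simp_all add: power_mult_distrib)
  have pos: "0 \<le> \<mu> j ^ (2 * m)"
    using mu(1)[of j] by simp
  have "W m g j \<le> \<mu> j ^ (2 * m) * (K\<^sup>2 * (\<mu> j)\<^sup>2 * ?a + K\<^sup>2 * (\<mu> j)\<^sup>2 * ?b)"
    unfolding g by (intro mult_left_mono add_mono mult_right_mono up pos) auto
  then show "W m g j \<le> K\<^sup>2 * W (m + 1) w j"
    unfolding w by (simp add: algebra_simps)
  have "\<mu> j ^ (2 * m) * (\<delta>\<^sup>2 * (\<mu> j)\<^sup>2 * ?a + \<delta>\<^sup>2 * (\<mu> j)\<^sup>2 * ?b) \<le> W m g j"
    unfolding g by (intro mult_left_mono add_mono mult_right_mono low pos) auto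
  then have "\<delta>\<^sup>2 * W (m + 1) w j \<le> W m g j"
    unfolding w by (simp add: algebra_simps)
  then show "W (m + 1) w j \<le> (1 / \<delta>)\<^sup>2 * W m g j"
    using \<delta>(1) by (simp add: power_divide pos_le_divide_eq mult.commute)
qed

lemma W_multiplier_norm:
  assumes "\<And>j. g \<bullet> P j = (\<mu> j + c) * (w \<bullet> P j)" "\<And>j. g \<bullet> N j = (- \<mu> j + c) * (w \<bullet> N j)"
  shows "summable (W (m + 1) w) \<Longrightarrow> summable (W m g)"
    and "summable (W (m + 1) w) \<Longrightarrow> Wnorm m g \<le> K * Wnorm (m + 1) w"
    and "summable (W m g) \<Longrightarrow> summable (W (m + 1) w)"
    and "summable (W m g) \<Longrightarrow> Wnorm (m + 1) w \<le> 1 / \<delta> * Wnorm m g"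
  unfolding W_norm_def
  using sqrt_suminf_scale[OF _ W_nonneg W_multiplier(1)[OF assms] K_bound(1)]
    sqrt_suminf_scale[OF _ W_nonneg W_multiplier(2)[OF assms]] \<delta>(1)
  by simp_all

lemma multiplier_nonzero: "\<mu> j + c \<noteq> 0" "- \<mu> j + c \<noteq> 0"
  using \<delta> mu(1)[of j] by (metis abs_zero mult_pos_pos not_le)+

lemma S_op_eq: "(w, v) \<in> S_graph \<Omega> \<Longrightarrow> S_op \<Omega> w = v"
  unfolding S_op_def by (rule the_equality) (auto intro: T_unique)

text \<open>The domain of \<open>S_op\<close> needs only the weight
  \<open>(\<mu> j)\<^sup>2\<close>. Since \<open>\<mu> j / \<mu> 0 \<ge> 1\<close>, it is dominated
  by the weight of order \<open>m + 1\<close> up to the constant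
  \<open>(1 / \<mu> 0) ^ (2 * m)\<close>.\<close>

lemma S_op_mem:
  assumes "w \<in> Wspace (m + 1)"
  shows "(w, S_op \<Omega> w) \<in> S_graph \<Omega>"
proof -
  have "summable (\<lambda>j. (\<mu> j)\<^sup>2 * ((w \<bullet> P j)\<^sup>2 + (w \<bullet> N j)\<^sup>2))"
  proof (rule summable_comparison_test')
    show "summable (\<lambda>j. (1 / \<mu> 0) ^ (2 * m) * W (m + 1) w j)"
      using assms by (intro summable_mult) (simp add: W_space_def)
    fix j :: nat
    let ?x = "(\<mu> j)\<^sup>2 * ((w \<bullet> P j)\<^sup>2 + (w \<bullet> N j)\<^sup>2)"
    have "\<mu> 0 \<le> \<mu> j"
      using mu(2) by (simp add: incseq_def)
    then have "1 \<le> (\<mu> j / \<mu> 0) ^ (2 * m)"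
      using mu(1)[of 0] by (intro one_le_power) simp
    then have "?x \<le> (\<mu> j / \<mu> 0) ^ (2 * m) * ?x"
      using mult_right_mono[of 1 "(\<mu> j / \<mu> 0) ^ (2 * m)" ?x] by simp
    moreover have "(\<mu> j / \<mu> 0) ^ (2 * m) * ?x = (1 / \<mu> 0) ^ (2 * m) * W (m + 1) w j"
      by (simp add: W_term_def power_divide power_add power2_eq_square mult_ac)
    moreover have "norm ?x = ?x"
      by simp
    ultimately show "norm ?x \<le> (1 / \<mu> 0) ^ (2 * m) * W (m + 1) w j"
      by simp
  qed
  then have "\<exists>v. (w, v) \<in> S_graph \<Omega>"
    using assms by (intro mem_T_exists) (auto simp: W_space_def)
  then show ?thesis
    using S_op_eq by auto
qed

definition R :: "l2 \<Rightarrow> l2" where "R w = S_op \<Omega> w + c *\<^sub>R w"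

lemma R_coeffs:
  assumes "w \<in> Wspace (m + 1)"
  shows "R w \<in> V0 \<Omega>" "R w \<bullet> P j = (\<mu> j + c) * (w \<bullet> P j)" "R w \<bullet> N j = (- \<mu> j + c) * (w \<bullet> N j)"
  using S_op_mem[OF assms] subspace_add[OF subspace_H] subspace_scale[OF subspace_H]
  by (auto simp: R_def mem_T_iff inner_add_left algebra_simps)

lemma R_mem: "w \<in> Wspace (m + 1) \<Longrightarrow> R w \<in> Wspace m"
  using W_multiplier_norm(1)[OF R_coeffs(2,3)] R_coeffs(1) by (auto simp: W_space_def)

lemma R_diff_norm:
  assumes "v \<in> Wspace (m + 1)" "w \<in> Wspace (m + 1)"
  shows "Wnorm m (R v - R w) \<le> K * Wnorm (m + 1) (v - w)"
    and "Wnorm (m + 1) (v - w) \<le> 1 / \<delta> * Wnorm m (R v - R w)"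
proof -
  have *: "(R v - R w) \<bullet> P j = (\<mu> j + c) * ((v - w) \<bullet> P j)"
    "(R v - R w) \<bullet> N j = (- \<mu> j + c) * ((v - w) \<bullet> N j)" for j
    by (simp_all add: inner_diff_left R_coeffs[OF assms(1)] R_coeffs[OF assms(2)] right_diff_distrib)
  show "Wnorm m (R v - R w) \<le> K * Wnorm (m + 1) (v - w)"
    by (rule W_multiplier_norm(2)[OF *]) (use W_diff[OF assms] in \<open>simp add: W_space_def\<close>)
  show "Wnorm (m + 1) (v - w) \<le> 1 / \<delta> * Wnorm m (R v - R w)"
    by (rule W_multiplier_norm(4)[OF *])
      (use W_diff[OF R_mem[OF assms(1)] R_mem[OF assms(2)]] in \<open>simp add: W_space_def\<close>)
qed

text \<open>Injectivity divides coefficients by nonzero factors. For surjectivity the divided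
  coefficients must first define a field in \<open>V0\<close>, and only then does the weighted
  estimate place that field in the space of order \<open>m + 1\<close>.\<close>

lemma bij_R: "bij_betw R (Wspace (m + 1)) (Wspace m)"
proof (rule bij_betw_imageI)
  show "inj_on R (Wspace (m + 1))"
  proof (rule inj_onI)
    fix v w assume vw: "v \<in> Wspace (m + 1)" "w \<in> Wspace (m + 1)" and "R v = R w"
    then have "v \<bullet> P j = w \<bullet> P j" "v \<bullet> N j = w \<bullet> N j" for j
      using R_coeffs(2,3)[OF vw(1), of j] R_coeffs(2,3)[OF vw(2), of j] multiplier_nonzero[of j]
      by simp_all
    then show "v = w"
      using vw by (intro eq_if_coeffs_eq) (auto simp: W_space_def)
  qed
  show "R ` Wspace (m + 1) = Wspace m"
  proof
    show "R ` Wspace (m + 1) \<subseteq> Wspace m"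
      using R_mem by auto
    show "Wspace m \<subseteq> R ` Wspace (m + 1)"
    proof
      fix g assume g: "g \<in> Wspace m"
      let ?a = "\<lambda>j. (g \<bullet> P j) / (\<mu> j + c)" and ?b = "\<lambda>j. (g \<bullet> N j) / (- \<mu> j + c)"
      \<comment> \<open>A lower bound for all \<open>\<bar>\<plusminus>\<mu> j + c\<bar>\<close>
        that does not depend on \<open>j\<close>, so that division preserves square
        summability.\<close>
      let ?D = "\<delta> * \<mu> 0"
      have D: "0 < ?D"
        using \<delta>(1) mu(1)[of 0] by simp
      have div: "(x / y)\<^sup>2 \<le> (1 / ?D)\<^sup>2 * x\<^sup>2" if "?D \<le> \<bar>y\<bar>" for x y :: real
      proof -
        have "\<bar>x / y\<bar> \<le> \<bar>x\<bar> / ?D"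
          using that D by (simp add: abs_divide frac_le)
        then have "\<bar>x / y\<bar>\<^sup>2 \<le> (\<bar>x\<bar> / ?D)\<^sup>2"
          by (intro power_mono) auto
        then show ?thesis
          by (simp add: power_divide)
      qed
      have "summable (\<lambda>j. (?a j)\<^sup>2 + (?b j)\<^sup>2)"
      proof (rule summable_comparison_test')
        show "summable (\<lambda>j. (1 / ?D)\<^sup>2 * ((g \<bullet> P j)\<^sup>2 + (g \<bullet> N j)\<^sup>2))"
          by (intro summable_mult Bessel)
        fix j :: nat
        have "?D \<le> \<delta> * \<mu> j"
          using mu(2) \<delta>(1) by (intro mult_left_mono) (auto simp: incseq_def)
        then have "?D \<le> \<bar>\<mu> j + c\<bar>" "?D \<le> \<bar>- \<mu> j + c\<bar>"
          using \<delta>(2,3)[of j] by linarith+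
        from add_mono[OF div[OF this(1)] div[OF this(2)]]
        show "norm ((?a j)\<^sup>2 + (?b j)\<^sup>2) \<le> (1 / ?D)\<^sup>2 * ((g \<bullet> P j)\<^sup>2 + (g \<bullet> N j)\<^sup>2)"
          by (simp add: distrib_left)
      qed
      then obtain w where w: "w \<in> V0 \<Omega>" "\<And>j. w \<bullet> P j = ?a j" "\<And>j. w \<bullet> N j = ?b j"
        by (rule Riesz_Fischer) blast
      have coeffs: "g \<bullet> P j = (\<mu> j + c) * (w \<bullet> P j)" "g \<bullet> N j = (- \<mu> j + c) * (w \<bullet> N j)" for j
        using multiplier_nonzero[of j] by (simp_all add: w(2,3))
      have wW: "w \<in> Wspace (m + 1)"
        using W_multiplier_norm(3)[OF coeffs] g w(1) by (simp add: W_space_def)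
      have "R w = g"
        using g by (intro eq_if_coeffs_eq) (auto simp: R_coeffs[OF wW] coeffs W_space_def)
      then show "g \<in> R ` Wspace (m + 1)"
        using wW by blast
    qed
  qed
qed

end

section \<open>The operator on the sum spaces\<close>

locale rot_plus_setting = rot_multiplier \<Omega> qp qm \<mu> c \<delta>
  for \<Omega> qp qm \<mu> c \<delta> +
  fixes \<nu> :: "nat \<Rightarrow> real" and k :: int
  assumes \<nu>: "\<And>j. 0 < \<nu> j" and c_nonzero: "c \<noteq> 0"
begin

abbreviation Cspace :: "nat \<Rightarrow> ((nat \<Rightarrow> real) \<times> l2) set" where
  "Cspace \<equiv> C_space \<Omega> \<nu> \<mu> qp qm k"
abbreviation Cdist :: "nat \<Rightarrow> (nat \<Rightarrow> real) \<times> l2 \<Rightarrow> (nat \<Rightarrow> real) \<times> l2 \<Rightarrow> real" where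
  "Cdist \<equiv> C_dist \<Omega> \<nu> \<mu> qp qm k"

lemma Metric_space_C: "Metric_space (Cspace m) (Cdist m)"
proof
  show "0 \<le> Cdist m u v" for u v
    by (simp add: C_dist_def)
  show "Cdist m u v = Cdist m v u" for u v
    using W_minus[of m "snd u - snd v"] by (simp add: C_dist_def A_norm_def W_norm_def power2_commute)
  show "Cdist m u v = 0 \<longleftrightarrow> u = v" if "u \<in> Cspace m" "v \<in> Cspace m" for u v
  proof -
    have "Cdist m u v = 0 \<longleftrightarrow> A_norm \<nu> k (\<lambda>j. fst u j - fst v j) = 0 \<and> Wnorm m (snd u - snd v) = 0"
      by (simp add: C_dist_def sum_power2_eq_zero_iff)
    also have "\<dots> \<longleftrightarrow> fst u = fst v \<and> snd u = snd v"
      using that by (simp add: A_norm_diff_eq_0_iff[OF \<nu>] Wnorm_diff_eq_0_iff C_space_def mem_Times_iff)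
    finally show ?thesis
      by (simp add: prod_eq_iff)
  qed
  show "Cdist m u w \<le> Cdist m u v + Cdist m v w"
    if "u \<in> Cspace m" "v \<in> Cspace m" "w \<in> Cspace m" for u v w
  proof -
    have A: "fst u \<in> A_space \<nu> k" "fst v \<in> A_space \<nu> k" "fst w \<in> A_space \<nu> k"
      and W: "snd u \<in> Wspace m" "snd v \<in> Wspace m" "snd w \<in> Wspace m"
      using that by (auto simp: C_space_def)
    \<comment> \<open>The triangle inequality is applied in each component, and afterwards in the
      plane to the pair of norms.\<close>
    have "Cdist m u w \<le> sqrt (
        (A_norm \<nu> k (\<lambda>j. fst u j - fst v j) + A_norm \<nu> k (\<lambda>j. fst v j - fst w j))\<^sup>2 +
        (Wnorm m (snd u - snd v) + Wnorm m (snd v - snd w))\<^sup>2)"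
      unfolding C_dist_def
      by (intro real_sqrt_le_mono add_mono power_mono A_norm_diff_triangle Wnorm_diff_triangle
          A_norm_nonneg Wnorm_nonneg A_diff W_diff \<nu> A W)
    also have "\<dots> \<le> Cdist m u v + Cdist m v w"
      unfolding C_dist_def by (rule real_sqrt_sum_squares_triangle_ineq)
    finally show ?thesis .
  qed
qed

text \<open>Absolute values make the larger constant nonnegative, so it can be taken out of the
  square root without sign conditions on \<open>l\<close> and \<open>l'\<close>.\<close>

lemma C_dist_scale:
  assumes "u \<in> Cspace m" "v \<in> Cspace m" "u' \<in> Cspace m'" "v' \<in> Cspace m'"
    and A: "A_norm \<nu> k (\<lambda>j. fst u' j - fst v' j) \<le> l * A_norm \<nu> k (\<lambda>j. fst u j - fst v j)"
    and W: "Wnorm m' (snd u' - snd v') \<le> l' * Wnorm m (snd u - snd v)"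
  shows "Cdist m' u' v' \<le> max \<bar>l\<bar> \<bar>l'\<bar> * Cdist m u v"
proof -
  let ?L = "max \<bar>l\<bar> \<bar>l'\<bar>"
  let ?a = "A_norm \<nu> k (\<lambda>j. fst u j - fst v j)" and ?a' = "A_norm \<nu> k (\<lambda>j. fst u' j - fst v' j)"
  let ?w = "Wnorm m (snd u - snd v)" and ?w' = "Wnorm m' (snd u' - snd v')"
  have nonneg: "0 \<le> ?a" "0 \<le> ?a'" "0 \<le> ?w" "0 \<le> ?w'"
    using assms(1-4)
    by (auto simp: C_space_def intro!: A_norm_nonneg Wnorm_nonneg A_diff W_diff \<nu>)
  have "l * ?a \<le> ?L * ?a" "l' * ?w \<le> ?L * ?w"
    using nonneg by (auto intro!: mult_right_mono)
  with A W have "?a' \<le> ?L * ?a" "?w' \<le> ?L * ?w"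
    by linarith+
  then have "?a'\<^sup>2 + ?w'\<^sup>2 \<le> (?L * ?a)\<^sup>2 + (?L * ?w)\<^sup>2"
    using nonneg by (intro add_mono power_mono)
  then have "?a'\<^sup>2 + ?w'\<^sup>2 \<le> ?L\<^sup>2 * (?a\<^sup>2 + ?w\<^sup>2)"
    by (simp only: power_mult_distrib distrib_left)
  then have "sqrt (?a'\<^sup>2 + ?w'\<^sup>2) \<le> sqrt (?L\<^sup>2 * (?a\<^sup>2 + ?w\<^sup>2))"
    by (rule real_sqrt_le_mono)
  also have "\<dots> = ?L * sqrt (?a\<^sup>2 + ?w\<^sup>2)"
    by (simp add: real_sqrt_mult)
  finally show ?thesis
    by (simp only: C_dist_def)
qed

lemma rot_plus_eq: "rot_plus \<Omega> c = map_prod (\<lambda>a j. c * a j) R"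
  by (auto simp: fun_eq_iff rot_plus_def rot_C_def R_def)

text \<open>The inverse is division by \<open>c\<close>; both maps change each coefficient by a
  constant factor, so the order of the space does not move.\<close>

lemma bij_A: "bij_betw (\<lambda>a j. c * a j) (A_space \<nu> k) (A_space \<nu> k)"
proof (rule bij_betw_byWitness[where f' = "\<lambda>a j. a j / c"])
  show "(\<lambda>a j. c * a j) ` A_space \<nu> k \<subseteq> A_space \<nu> k"
    using A_scale(1)[OF \<nu>, where L = "\<bar>c\<bar>"] by (auto simp: abs_mult)
  show "(\<lambda>a j. a j / c) ` A_space \<nu> k \<subseteq> A_space \<nu> k"
    using A_scale(1)[OF \<nu>, where L = "1 / \<bar>c\<bar>"] by (auto simp: abs_divide)
qed (use c_nonzero in auto)

lemma bij_rot_plus: "bij_betw (rot_plus \<Omega> c) (Cspace (m + 1)) (Cspace m)"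
  unfolding rot_plus_eq C_space_def by (intro bij_betw_map_prod bij_A bij_R)

lemma rot_plus_mem: "u \<in> Cspace (m + 1) \<Longrightarrow> rot_plus \<Omega> c u \<in> Cspace m"
  using bij_rot_plus bij_betwE by blast

text \<open>The first estimate is the Lipschitz bound for the operator. The second, evaluated at
  preimages, is the Lipschitz bound for its inverse.\<close>

lemma rot_plus_dist:
  assumes "u \<in> Cspace (m + 1)" "v \<in> Cspace (m + 1)"
  shows "Cdist m (rot_plus \<Omega> c u) (rot_plus \<Omega> c v) \<le> max \<bar>\<bar>c\<bar>\<bar> \<bar>K\<bar> * Cdist (m + 1) u v"
    and "Cdist (m + 1) u v \<le>
      max \<bar>1 / \<bar>c\<bar>\<bar> \<bar>1 / \<delta>\<bar> * Cdist m (rot_plus \<Omega> c u) (rot_plus \<Omega> c v)"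
proof -
  have A: "(\<lambda>j. fst u j - fst v j) \<in> A_space \<nu> k"
    and W: "snd u \<in> Wspace (m + 1)" "snd v \<in> Wspace (m + 1)"
    using assms by (auto simp: C_space_def intro: A_diff[OF \<nu>])
  have A': "(\<lambda>j. c * fst u j - c * fst v j) \<in> A_space \<nu> k"
    by (rule A_scale(1)[OF \<nu> A, where L = "\<bar>c\<bar>"]) (simp_all add: right_diff_distrib[symmetric] abs_mult)
  have fst_eq: "fst (rot_plus \<Omega> c x) j = c * fst x j" and snd_eq: "snd (rot_plus \<Omega> c x) = R (snd x)" for x j
    by (simp_all add: rot_plus_eq)
  show "Cdist m (rot_plus \<Omega> c u) (rot_plus \<Omega> c v) \<le> max \<bar>\<bar>c\<bar>\<bar> \<bar>K\<bar> * Cdist (m + 1) u v"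
  proof (rule C_dist_scale[OF assms assms[THEN rot_plus_mem]], unfold fst_eq snd_eq)
    show "A_norm \<nu> k (\<lambda>j. c * fst u j - c * fst v j) \<le> \<bar>c\<bar> * A_norm \<nu> k (\<lambda>j. fst u j - fst v j)"
      by (rule A_scale(2)[OF \<nu> A]) (simp_all add: right_diff_distrib[symmetric] abs_mult)
  qed (rule R_diff_norm[OF W])
  show "Cdist (m + 1) u v \<le>
      max \<bar>1 / \<bar>c\<bar>\<bar> \<bar>1 / \<delta>\<bar> * Cdist m (rot_plus \<Omega> c u) (rot_plus \<Omega> c v)"
  proof (rule C_dist_scale[OF assms[THEN rot_plus_mem] assms], unfold fst_eq snd_eq)
    show "A_norm \<nu> k (\<lambda>j. fst u j - fst v j)
        \<le> 1 / \<bar>c\<bar> * A_norm \<nu> k (\<lambda>j. c * fst u j - c * fst v j)"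
      by (rule A_scale(2)[OF \<nu> A']) (use c_nonzero in \<open>simp_all add: right_diff_distrib[symmetric] abs_mult\<close>)
  qed (rule R_diff_norm[OF W])
qed

lemma rot_plus_homeomorphism:
  shows "continuous_map (C_topology \<Omega> \<nu> \<mu> qp qm k (m + 1)) (C_topology \<Omega> \<nu> \<mu> qp qm k m) (rot_plus \<Omega> c)"
    and "continuous_map (C_topology \<Omega> \<nu> \<mu> qp qm k m) (C_topology \<Omega> \<nu> \<mu> qp qm k (m + 1))
      (inv_into (Cspace (m + 1)) (rot_plus \<Omega> c))"
proof -
  show "continuous_map (C_topology \<Omega> \<nu> \<mu> qp qm k (m + 1)) (C_topology \<Omega> \<nu> \<mu> qp qm k m) (rot_plus \<Omega> c)"
    unfolding C_topology_def
    by (rule continuous_map_Lipschitz[OF Metric_space_C Metric_space_C _ rot_plus_dist(1)])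
      (use rot_plus_mem in auto)
  let ?S = "inv_into (Cspace (m + 1)) (rot_plus \<Omega> c)"
  have inv: "?S u \<in> Cspace (m + 1)" "rot_plus \<Omega> c (?S u) = u" if "u \<in> Cspace m" for u
    using that bij_rot_plus[of m] by (auto simp: bij_betw_def intro: inv_into_into f_inv_into_f)
  show "continuous_map (C_topology \<Omega> \<nu> \<mu> qp qm k m) (C_topology \<Omega> \<nu> \<mu> qp qm k (m + 1)) ?S"
    unfolding C_topology_def
  proof (rule continuous_map_Lipschitz[OF Metric_space_C Metric_space_C])
    show "?S ` Cspace m \<subseteq> Cspace (m + 1)"
      using inv(1) by blast
    show "Cdist (m + 1) (?S u) (?S v) \<le> max \<bar>1 / \<bar>c\<bar>\<bar> \<bar>1 / \<delta>\<bar> * Cdist m u v"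
      if "u \<in> Cspace m" "v \<in> Cspace m" for u v
      using rot_plus_dist(2)[OF inv(1)[OF that(1)] inv(1)[OF that(2)]] by (simp only: inv(2) that)
  qed
qed

end

text \<open>Past an index where \<open>\<mu> j\<close> exceeds \<open>2 * \<bar>c\<bar>\<close>, the
  shift costs at most half of \<open>\<mu> j\<close>. The finitely many earlier quotients are
  positive and have a positive minimum.\<close>

lemma multiplier_lower_bound:
  fixes \<mu> :: "nat \<Rightarrow> real"
  assumes mu: "\<And>j. 0 < \<mu> j" "incseq \<mu>" and unbounded: "\<And>M. \<exists>j. M < \<mu> j"
    and c: "\<And>j. c \<noteq> \<mu> j" "\<And>j. c \<noteq> - \<mu> j"
  obtains \<delta> where "0 < \<delta>" "\<And>j. \<delta> * \<mu> j \<le> \<bar>\<mu> j + c\<bar>" "\<And>j. \<delta> * \<mu> j \<le> \<bar>- \<mu> j + c\<bar>"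
proof -
  obtain N where N: "2 * \<bar>c\<bar> < \<mu> N"
    using unbounded by blast
  define d where "d j = min (\<bar>\<mu> j + c\<bar> / \<mu> j) (\<bar>- \<mu> j + c\<bar> / \<mu> j)" for j
  \<comment> \<open>The inserted \<open>1 / 2\<close> is the constant for the tail, and it also
    keeps the set nonempty when \<open>N = 0\<close>.\<close>
  define \<delta> where "\<delta> = Min (insert (1 / 2) (d ` {..<N}))"
  have d_pos: "0 < d j" for j
    using mu(1)[of j] c[of j] by (auto simp: d_def)
  have pos: "0 < \<delta>"
    unfolding \<delta>_def by (subst Min_gr_iff) (auto simp: d_pos)
  have "\<delta> * \<mu> j \<le> \<bar>\<mu> j + c\<bar> \<and> \<delta> * \<mu> j \<le> \<bar>- \<mu> j + c\<bar>" for j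
  proof (cases "j < N")
    case True
    then have "\<delta> \<le> d j"
      unfolding \<delta>_def by (intro Min_le) auto
    then have "\<delta> \<le> \<bar>\<mu> j + c\<bar> / \<mu> j" "\<delta> \<le> \<bar>- \<mu> j + c\<bar> / \<mu> j"
      by (simp_all add: d_def)
    then show ?thesis
      using mu(1)[of j] by (simp add: pos_le_divide_eq)
  next
    case False
    then have "2 * \<bar>c\<bar> < \<mu> j"
      using N incseqD[OF mu(2), of N j] by simp
    moreover have "\<delta> \<le> 1 / 2"
      unfolding \<delta>_def by (intro Min_le) auto
    then have "\<delta> * \<mu> j \<le> 1 / 2 * \<mu> j"
      using mu(1)[of j] by (intro mult_right_mono) auto
    ultimately show ?thesis by linarith
  qed
  with pos show thesis
    using that by blast
qed

theorem mainTheorem7: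
  fixes \<Omega> :: "(real^3) set"
    and q qp qm :: "nat \<Rightarrow> real^3 \<Rightarrow> real^3"
    and \<nu> \<mu> :: "nat \<Rightarrow> real"
    and c :: real and m :: nat and k :: int
  assumes domain: "open \<Omega>" "connected \<Omega>" "bounded \<Omega>" "smooth_boundary \<Omega>"
      "\<Omega> homeomorphic ball (0 :: real^3) 1"
    and q_basis: "orthonormal_basis_of (\<lambda>j. l2class \<Omega> (q j)) (gradient_fields \<Omega>)"
    and q_smooth: "\<And>j. smooth_upto_boundary \<Omega> (q j)"
    and q_eigen: "\<And>j x. x \<in> \<Omega> \<Longrightarrow> - grad (divergence (q j)) x = (\<nu> j)\<^sup>2 *\<^sub>R q j x"
    and q_trace: "\<And>j. normal_trace_zero \<Omega> (q j)"
    and nu: "\<And>j. 0 < \<nu> j" "incseq \<nu>"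
    and S_selfadjoint: "self_adjoint_in (V0 \<Omega>) (S_graph \<Omega>)"
    and qpm_basis: "orthonormal_basis_of
          (case_sum (\<lambda>j. l2class \<Omega> (qp j)) (\<lambda>j. l2class \<Omega> (qm j))) (V0 \<Omega>)"
    and qpm_smooth: "\<And>j. smooth_upto_boundary \<Omega> (qp j)" "\<And>j. smooth_upto_boundary \<Omega> (qm j)"
    and qp_eigen: "\<And>j x. x \<in> \<Omega> \<Longrightarrow> rot (qp j) x = \<mu> j *\<^sub>R qp j x"
    and qm_eigen: "\<And>j x. x \<in> \<Omega> \<Longrightarrow> rot (qm j) x = - \<mu> j *\<^sub>R qm j x"
    and qpm_trace: "\<And>j. normal_trace_zero \<Omega> (qp j)" "\<And>j. normal_trace_zero \<Omega> (qm j)"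
    and mu: "\<And>j. 0 < \<mu> j" "incseq \<mu>"
    and c: "c \<notin> Sp_rot \<Omega>"
    and m: "0 < m"
  shows "bij_betw (rot_plus \<Omega> c) (C_space \<Omega> \<nu> \<mu> qp qm k (m + 1)) (C_space \<Omega> \<nu> \<mu> qp qm k m) \<and>
    continuous_map (C_topology \<Omega> \<nu> \<mu> qp qm k (m + 1)) (C_topology \<Omega> \<nu> \<mu> qp qm k m)
      (rot_plus \<Omega> c) \<and>
    bij_betw (inv_into (C_space \<Omega> \<nu> \<mu> qp qm k (m + 1)) (rot_plus \<Omega> c))
      (C_space \<Omega> \<nu> \<mu> qp qm k m) (C_space \<Omega> \<nu> \<mu> qp qm k (m + 1)) \<and>
    continuous_map (C_topology \<Omega> \<nu> \<mu> qp qm k m) (C_topology \<Omega> \<nu> \<mu> qp qm k (m + 1))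
      (inv_into (C_space \<Omega> \<nu> \<mu> qp qm k (m + 1)) (rot_plus \<Omega> c))"
proof -
  have nonempty: "\<Omega> \<noteq> {}"
    using domain(5) homeomorphic_empty(2) by auto
  let ?P = "\<lambda>j. l2class \<Omega> (qp j)" and ?N = "\<lambda>j. l2class \<Omega> (qm j)"
  interpret basis: paired_basis ?P ?N "V0 \<Omega>"
    using qpm_basis by unfold_locales
  interpret diagonal_self_adjoint ?P ?N "V0 \<Omega>" "S_graph \<Omega>" \<mu>
  proof
    show "(?P j, \<mu> j *\<^sub>R ?P j) \<in> S_graph \<Omega>" for j
      using weak_rot_eigenfield[OF domain(1,3) qpm_smooth(1) qp_eigen] basis.basis_mem
        subspace_scale[OF basis.subspace_H]
      by (auto simp: S_graph_def)
    show "(?N j, - \<mu> j *\<^sub>R ?N j) \<in> S_graph \<Omega>" for j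
      using weak_rot_eigenfield[OF domain(1,3) qpm_smooth(2) qm_eigen] basis.basis_mem(2)[of j]
        subspace_scale[OF basis.subspace_H basis.basis_mem(2)[of j], of "- \<mu> j"]
      by (simp add: S_graph_def)
  qed (rule S_selfadjoint)
  \<comment> \<open>Unit norm makes the classes nonzero, so the eigenfields count as nontrivial
    solutions in \<open>Sp_rot\<close>.\<close>
  have "?P j \<noteq> 0" "?N j \<noteq> 0" for j
    using basis.orthonormal(1,2)[of j j] by auto
  then have "\<mu> j \<in> Sp_rot \<Omega>" "- \<mu> j \<in> Sp_rot \<Omega>" for j
    using eigenvalue_in_Sp_rot[OF domain(1) qpm_smooth(1) qp_eigen qpm_trace(1)]
      eigenvalue_in_Sp_rot[OF domain(1) qpm_smooth(2) qm_eigen qpm_trace(2)] by blast+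
  \<comment> \<open>Both signs matter: \<open>\<mu> j + c\<close> vanishes at
    \<open>c = - \<mu> j\<close>, and \<open>- \<mu> j + c\<close> at
    \<open>c = \<mu> j\<close>.\<close>
  with c have c_ne: "c \<noteq> \<mu> j" "c \<noteq> - \<mu> j" for j
    by metis+
  have "\<exists>j. M < \<mu> j" for M
  proof (rule ccontr)
    assume "\<nexists>j. M < \<mu> j"
    then have M: "\<bar>\<mu> j\<bar> \<le> M" for j
      using mu(1)[of j] by (simp add: not_less)
    obtain w where w: "w \<in> V0 \<Omega>" "\<And>v. weak_rot \<Omega> w v \<Longrightarrow> M * norm w < norm v"
      using weak_rot_unbounded_on_V0[OF domain(1,3) nonempty] by blast
    obtain v where "(w, v) \<in> S_graph \<Omega>" "norm v \<le> M * norm w"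
      using bounded_if_eigenvalues_bounded[OF M w(1)] by blast
    then show False
      using w(2)[of v] by (simp add: S_graph_def)
  qed
  then obtain \<delta> where "0 < \<delta>" "\<And>j. \<delta> * \<mu> j \<le> \<bar>\<mu> j + c\<bar>" "\<And>j. \<delta> * \<mu> j \<le> \<bar>- \<mu> j + c\<bar>"
    using multiplier_lower_bound[OF mu _ c_ne] by metis
  \<comment> \<open>This is what makes the operator invertible on the gradient component, where it
    is multiplication by \<open>c\<close>.\<close>
  moreover have "c \<noteq> 0"
    using c zero_in_Sp_rot[OF domain(1,3) nonempty] by auto
  ultimately interpret rot_plus_setting \<Omega> qp qm \<mu> c \<delta> \<nu> k
    using mu nu(1) by unfold_locales
  show ?thesis
    using bij_rot_plus[of m] rot_plus_homeomorphism[of m] bij_betw_inv_into by blast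
qed

end
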